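(* Let $A=Z\times\mathbb T^s$ be a compact abelian Lie group, where $Z$ is a finite abelian group of rank $r$, let $B=\mathbb Z^r\times\mathbb R^s$ be the covering group of $A$ and $\pi:B\to A$ the covering homomorphism. Then for any free nilspace $F$, any $k\in\mathbb N$ and any continuous nilspace morphism $\phi:F\to\mathcal D_k(A)$, there exists a continuous nilspace morphism $\psi:F\to\mathcal D_k(B)$ such that $\phi=\pi\circ\psi$.
   Context: Nilspaces: a nilspace is a set $X$ with sets $C^n(X)\subseteq X^{\{0,1\}^n}$ of $n$-cubes closed under composition with discrete-cube morphisms (maps $\{0,1\}^m\to\{0,1\}^n$ with coordinate functions $v\mapsto0,1,v_j,1-v_j$), with $C^1(X)=X^{\{0,1\}}$ and every $n$-corner extending to a cube; morphisms send cubes to cubes; products have coordinatewise cubes. For an abelian group $G$ and $k\ge1$, $\mathcal D_k(G)$ is $G$ with $n$-cubes the maps $c$ with $\sum_{v\in\{0,1\}^{k+1}}(-1)^{|v|}c(\phi(v))=0$ for every discrete-cube morphism $\phi:\{0,1\}^{k+1}\to\{0,1\}^n$ ($|v|=\sum v_j$). A free nilspace is $\prod_{i=1}^m\mathcal D_i(\mathbb Z^{a_i}\times\mathbb R^{b_i})$ with the product topology. The rank $r$ of a finite abelian group $Z$ is the minimal number of generators, so $Z\cong\prod_{j=1}^r\mathbb Z/n_j\mathbb Z$; the covering homomorphism $\pi:\mathbb Z^r\times\mathbb R^s\to Z\times\mathbb T^s$ reduces each $\mathbb Z$-coordinate mod $n_j$ and each $\mathbb R$-coordinate mod $1$. *)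

theory Defs
  imports
    "HOL-Analysis.Analysis"
    "HOL-Algebra.FiniteProduct"
    "HOL-Algebra.Elementary_Groups"
    "HOL-Algebra.Product_Groups"
begin

section \<open>Discrete cubes and nilspace morphisms\<close>

text \<open>A vertex of the discrete \<open>n\<close>-cube is an extensional function on \<open>{..<n}\<close>, so that
  coordinates are numbered from \<open>0\<close>; maps out of a discrete cube are extensional as well.\<close>

definition vertices :: "nat \<Rightarrow> (nat \<Rightarrow> nat) set" where
  "vertices n = {..<n} \<rightarrow>\<^sub>E {0, 1}"

definition discrete_cube_morphisms :: "nat \<Rightarrow> nat \<Rightarrow> ((nat \<Rightarrow> nat) \<Rightarrow> (nat \<Rightarrow> nat)) set" where
  "discrete_cube_morphisms m n =
     {f \<in> vertices m \<rightarrow>\<^sub>E vertices n. \<forall>i<n.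
        (\<forall>v\<in>vertices m. f v i = 0) \<or> (\<forall>v\<in>vertices m. f v i = 1) \<or>
        (\<exists>j<m. \<forall>v\<in>vertices m. f v i = v j) \<or> (\<exists>j<m. \<forall>v\<in>vertices m. f v i = 1 - v j)}"

text \<open>A set of points together with its \<open>n\<close>-cubes. A nilspace is such a structure with three further
  axioms; they are not recorded here, since being a morphism depends on the cubes alone and the
  only instances considered are \<open>D\<^sub>k(G)\<close> with \<open>k \<ge> 1\<close> and finite products of these.\<close>

record 'a cubespace =
  points :: "'a set"
  cubes :: "nat \<Rightarrow> ((nat \<Rightarrow> nat) \<Rightarrow> 'a) set"

definition nilspace_morphism :: "'a cubespace \<Rightarrow> 'b cubespace \<Rightarrow> ('a \<Rightarrow> 'b) \<Rightarrow> bool" where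
  "nilspace_morphism X Y f \<longleftrightarrow>
     f \<in> points X \<rightarrow> points Y \<and>
     (\<forall>n. \<forall>c\<in>cubes X n. (\<lambda>v\<in>vertices n. f (c v)) \<in> cubes Y n)"

definition product_cubespace :: "'i set \<Rightarrow> ('i \<Rightarrow> 'a cubespace) \<Rightarrow> ('i \<Rightarrow> 'a) cubespace" where
  "product_cubespace I X =
     \<lparr>points = (\<Pi>\<^sub>E i\<in>I. points (X i)),
      cubes = (\<lambda>n. {c \<in> vertices n \<rightarrow>\<^sub>E (\<Pi>\<^sub>E i\<in>I. points (X i)).
                      \<forall>i\<in>I. (\<lambda>v\<in>vertices n. c v i) \<in> cubes (X i) n})\<rparr>"

text \<open>The nilspace \<open>D\<^sub>k(G)\<close>. As \<open>HOL-Algebra\<close> groups are written multiplicatively, the alternating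
  sum appears as a product of powers with exponents \<open>\<plusminus>1\<close>.\<close>

definition D_nilspace :: "nat \<Rightarrow> ('a, 'b) monoid_scheme \<Rightarrow> 'a cubespace" where
  "D_nilspace k G =
     \<lparr>points = carrier G,
      cubes = (\<lambda>n. {c \<in> vertices n \<rightarrow>\<^sub>E carrier G. \<forall>\<phi>\<in>discrete_cube_morphisms (k + 1) n.
                (\<Otimes>\<^bsub>G\<^esub>v\<in>vertices (k + 1). c (\<phi> v) [^]\<^bsub>G\<^esub> ((-1::int) ^ (\<Sum>j<k+1. v j))) = \<one>\<^bsub>G\<^esub>})\<rparr>"


section \<open>The groups \<open>\<int>\<^sup>a \<times> \<real>\<^sup>b\<close> and free nilspaces\<close>

definition real_group :: "real monoid" where
  "real_group = \<lparr>carrier = UNIV, monoid.mult = (+), one = 0\<rparr>"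

lemma comm_group_real_group: "comm_group real_group"
  unfolding real_group_def
  by (rule comm_groupI) (auto intro: exI[where x = "- x" for x])

definition ZR_group :: "nat \<Rightarrow> nat \<Rightarrow> ((nat \<Rightarrow> int) \<times> (nat \<Rightarrow> real)) monoid" where
  "ZR_group a b =
     product_group {..<a} (\<lambda>_. integer_group) \<times>\<times> product_group {..<b} (\<lambda>_. real_group)"

definition ZR_topology :: "nat \<Rightarrow> nat \<Rightarrow> ((nat \<Rightarrow> int) \<times> (nat \<Rightarrow> real)) topology" where
  "ZR_topology a b =
     prod_topology (product_topology (\<lambda>_. discrete_topology UNIV) {..<a})
                   (product_topology (\<lambda>_. euclideanreal) {..<b})"

definition free_nilspace ::
    "nat \<Rightarrow> (nat \<Rightarrow> nat) \<Rightarrow> (nat \<Rightarrow> nat) \<Rightarrow> (nat \<Rightarrow> (nat \<Rightarrow> int) \<times> (nat \<Rightarrow> real)) cubespace" where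
  "free_nilspace m a b = product_cubespace {1..m} (\<lambda>i. D_nilspace i (ZR_group (a i) (b i)))"

definition free_topology ::
    "nat \<Rightarrow> (nat \<Rightarrow> nat) \<Rightarrow> (nat \<Rightarrow> nat) \<Rightarrow> (nat \<Rightarrow> (nat \<Rightarrow> int) \<times> (nat \<Rightarrow> real)) topology" where
  "free_topology m a b = product_topology (\<lambda>i. ZR_topology (a i) (b i)) {1..m}"

lemma topspace_free_topology: "topspace (free_topology m a b) = points (free_nilspace m a b)"
  by (simp add: free_topology_def free_nilspace_def product_cubespace_def D_nilspace_def
      ZR_topology_def ZR_group_def real_group_def integer_group_def)


section \<open>The circle group \<open>\<real>/\<int>\<close>\<close>

definition circle_group :: "real set monoid" where
  "circle_group = real_group Mod \<int>"

definition circle_proj :: "real \<Rightarrow> real set" where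
  "circle_proj x = \<int> #>\<^bsub>real_group\<^esub> x"

text \<open>The quotient topology.\<close>

definition circle_topology :: "real set topology" where
  "circle_topology = topology (\<lambda>U. U \<subseteq> carrier circle_group \<and> open (circle_proj -` U))"

lemma openin_circle_topology:
  "openin circle_topology U \<longleftrightarrow> U \<subseteq> carrier circle_group \<and> open (circle_proj -` U)"
proof -
  have "istopology (\<lambda>U. U \<subseteq> carrier circle_group \<and> open (circle_proj -` U))"
    unfolding istopology_def by (auto simp: vimage_Union vimage_Int)
  then show ?thesis
    by (simp add: circle_topology_def topology_inverse')
qed

lemma range_circle_proj: "range circle_proj = carrier circle_group"
  by (auto simp: circle_proj_def circle_group_def FactGroup_def RCOSETS_def real_group_def)

lemma topspace_circle_topology: "topspace circle_topology = carrier circle_group"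
proof -
  have "circle_proj -` carrier circle_group = UNIV"
    using range_circle_proj by auto
  then have "openin circle_topology (carrier circle_group)"
    by (simp add: openin_circle_topology)
  then show ?thesis
    by (meson openin_circle_topology openin_subset openin_topspace subset_antisym)
qed

lemma quotient_map_circle_proj: "quotient_map euclideanreal circle_topology circle_proj"
  unfolding quotient_map_def topspace_circle_topology openin_circle_topology
  by (auto simp: range_circle_proj vimage_def)


section \<open>Compact abelian Lie groups and their covering groups\<close>

definition group_rank :: "('a, 'b) monoid_scheme \<Rightarrow> nat" where
  "group_rank G = (LEAST r. \<exists>S\<subseteq>carrier G. finite S \<and> card S = r \<and> generate G S = carrier G)"

definition lie_group ::
    "('z, 'q) monoid_scheme \<Rightarrow> nat \<Rightarrow> ('z \<times> (nat \<Rightarrow> real set)) monoid" where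
  "lie_group Z s = Z \<times>\<times> product_group {..<s} (\<lambda>_. circle_group)"

definition lie_topology ::
    "('z, 'q) monoid_scheme \<Rightarrow> nat \<Rightarrow> ('z \<times> (nat \<Rightarrow> real set)) topology" where
  "lie_topology Z s =
     prod_topology (discrete_topology (carrier Z)) (product_topology (\<lambda>_. circle_topology) {..<s})"

text \<open>The covering homomorphism depends on an identification
  \<open>h : (\<int>/n\<^sub>0\<int>) \<times> \<dots> \<times> (\<int>/n\<^bsub>r-1\<^esub>\<int>) \<rightarrow> Z\<close>. The elements of \<open>integer_mod_group q\<close> are the
  remainders \<open>0, \<dots>, q - 1\<close>.\<close>

definition covering_hom ::
    "nat \<Rightarrow> nat \<Rightarrow> (nat \<Rightarrow> nat) \<Rightarrow> ((nat \<Rightarrow> int) \<Rightarrow> 'z) \<Rightarrow>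
     (nat \<Rightarrow> int) \<times> (nat \<Rightarrow> real) \<Rightarrow> 'z \<times> (nat \<Rightarrow> real set)" where
  "covering_hom r s n h =
     (\<lambda>(x, y). (h (\<lambda>j\<in>{..<r}. x j mod int (n j)), \<lambda>j\<in>{..<s}. circle_proj (y j)))"

end

theory Submission
  imports Defs
begin

text \<open>
  Only real-valued functions matter: the characters of \<open>Z \<times> \<real>\<^sup>s/\<int>\<^sup>s\<close> obtained from the cyclic factors
  of \<open>Z\<close> and from the circle factors separate points, and each of them composed with \<open>\<phi>\<close> has the form
  \<open>z \<mapsto> exp (2\<pi>\<i>\<theta>(z))\<close>, where the alternating sum of \<open>\<theta>\<close> over every cube of dimension greater than \<open>k\<close>
  is an integer. One has to find a continuous \<open>\<psi>\<close> that is congruent to \<open>\<theta>\<close> modulo \<open>1\<close> and for which these sums vanish.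

  The components of a free nilspace are contractible, so a continuous \<open>\<psi>\<^sub>0\<close> congruent to \<open>\<theta>\<close> exists. Its
  alternating sums are integers and depend continuously on the cube. Scaling the real coordinates of
  the cube to \<open>0\<close> shows that they depend on the integer coordinates only. It remains to change
  a function on \<open>\<Prod>\<^sub>i D\<^sub>i(\<int>\<^bsup>a i\<^esup>)\<close> by integers so that its alternating sums vanish. This is done one
  integer coordinate \<open>e\<close>, of weight \<open>w\<close>, at a time: the difference in the direction \<open>e\<close> has degree \<open>k - w\<close>, so
  it can be corrected by induction on the degree, and summing it up from a corrected function on the
  hyperplane \<open>x\<^sub>e = 0\<close> gives the result.
\<close>

section \<open>Alternating sums and cubes over subsets\<close>

text \<open>A set \<open>W\<close> stands for the vertex of the cube on the directions
  \<open>U\<close> whose coordinates in \<open>W\<close> are 1 and whose others are 0;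
  \<open>card W\<close> is then the exponent |v| of the sign.\<close>

definition alt :: "nat set \<Rightarrow> (nat set \<Rightarrow> 'a::comm_ring_1) \<Rightarrow> 'a" where
  "alt U f = (\<Sum>W\<in>Pow U. (-1) ^ card W * f W)"

lemma alt_cong: "(\<And>W. W \<subseteq> U \<Longrightarrow> f W = g W) \<Longrightarrow> alt U f = alt U g"
  unfolding alt_def by (rule sum.cong) auto

lemma alt_empty [simp]: "alt {} f = f {}"
  by (simp add: alt_def)

lemma alt_zero [simp]: "alt U (\<lambda>_. 0) = 0"
  by (simp add: alt_def)

lemma alt_add: "alt U (\<lambda>W. f W + g W) = alt U f + alt U g"
  by (simp add: alt_def sum.distrib algebra_simps)

lemma alt_diff: "alt U (\<lambda>W. f W - g W) = alt U f - alt U g"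
  by (simp add: alt_def sum_subtractf algebra_simps)

lemma alt_mult_left: "alt U (\<lambda>W. s * f W) = s * alt U f"
  by (simp add: alt_def sum_distrib_left algebra_simps)

lemma alt_of_int: "alt U (\<lambda>W. of_int (f W)) = of_int (alt U f)"
  by (simp add: alt_def)

text \<open>Subsets of a disjoint union are pairs of subsets and the signs multiply, so the sum can
  be taken first over the faces parallel to \<open>N\<close>.\<close>

lemma alt_Un:
  assumes "finite N" "finite M" "N \<inter> M = {}"
  shows "alt (N \<union> M) f = alt M (\<lambda>B. alt N (\<lambda>A. f (A \<union> B)))"
proof -
  have "alt (N \<union> M) f = (\<Sum>(B, A)\<in>Pow M \<times> Pow N. (-1) ^ card (A \<union> B) * f (A \<union> B))"
    unfolding alt_def
    by (rule sum.reindex_bij_witness[of _ "\<lambda>(B, A). A \<union> B" "\<lambda>W. (W \<inter> M, W \<inter> N)"])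
      (use assms in \<open>auto simp: Int_Un_distrib[symmetric] Int_absorb2\<close>)
  also have "\<dots> = (\<Sum>(B, A)\<in>Pow M \<times> Pow N. (-1) ^ card B * ((-1) ^ card A * f (A \<union> B)))"
  proof (intro sum.cong refl, clarify)
    fix B A assume "B \<subseteq> M" "A \<subseteq> N"
    with assms have "card (A \<union> B) = card A + card B"
      by (intro card_Un_disjoint) (auto intro: finite_subset)
    then show "(-1) ^ card (A \<union> B) * f (A \<union> B) = (-1) ^ card B * ((-1) ^ card A * f (A \<union> B))"
      by (simp add: power_add)
  qed
  finally show ?thesis
    by (simp add: alt_def sum.cartesian_product sum_distrib_left)
qed

lemma alt_insert:
  assumes "finite U" "x \<notin> U"
  shows "alt (insert x U) f = alt U f - alt U (\<lambda>W. f (insert x W))"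
  using alt_Un[of U "{x}" f] assms by (simp add: alt_def[of "{x}"] Pow_insert)

text \<open>The vertices \<open>W\<close> and \<open>insert x W\<close> carry opposite signs, so a
  function that ignores the direction \<open>x\<close> cancels in pairs.\<close>

lemma alt_cancel:
  assumes "finite U" "x \<in> U" "\<And>W. W \<subseteq> U - {x} \<Longrightarrow> f (insert x W) = f W"
  shows "alt U f = 0"
proof -
  have "alt (U - {x}) (\<lambda>W. f (insert x W)) = alt (U - {x}) f"
    by (rule alt_cong) (use assms in auto)
  with alt_insert[of "U - {x}" x f] assms show ?thesis
    by (simp add: insert_absorb)
qed

lemma alt_const:
  assumes "finite U" "U \<noteq> {}"
  shows "alt U (\<lambda>_. y) = 0"
  using assms alt_cancel[of U _ "\<lambda>_. y"] by blast

lemma alt_top: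
  assumes "finite M"
  shows "alt M (\<lambda>B. if M \<subseteq> B then y else 0) = (-1) ^ card M * y"
proof -
  have "alt M (\<lambda>B. if M \<subseteq> B then y else 0) = (\<Sum>W\<in>{M}. (-1) ^ card W * (if M \<subseteq> W then y else 0))"
    unfolding alt_def by (rule sum.mono_neutral_right) (use assms in auto)
  then show ?thesis by simp
qed

text \<open>The sum over \<open>insert x U\<close> is the difference of the sums over two opposite
  faces; in the second one \<open>x\<close> has joined the base vertex \<open>T\<close>. Repeated
  splitting ends at faces of dimension \<open>d\<close>. The set \<open>A\<close> is later the
  integers.\<close>

lemma alt_mem_of_card_ge:
  assumes "finite N" "d \<le> card N"
    and "0 \<in> A" "\<And>x y. x \<in> A \<Longrightarrow> y \<in> A \<Longrightarrow> x - y \<in> A"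
    and "\<And>T U. T \<subseteq> N \<Longrightarrow> U \<subseteq> N \<Longrightarrow> T \<inter> U = {} \<Longrightarrow> card U = d \<Longrightarrow> alt U (\<lambda>W. f (T \<union> W)) \<in> A"
  shows "alt N f \<in> A"
proof -
  have "alt U (\<lambda>W. f (T \<union> W)) \<in> A" if "finite U" "T \<subseteq> N" "U \<subseteq> N" "T \<inter> U = {}" "d \<le> card U" for T U
    using that
  proof (induction U arbitrary: T rule: finite_induct)
    case empty
    then show ?case using assms(5)[of T "{}"] by auto
  next
    case (insert x U)
    show ?case
    proof (cases "card (insert x U) = d")
      case True
      then show ?thesis using insert.prems assms(5) by blast
    next
      case False
      then have "d \<le> card U" using insert by auto
      then have "alt U (\<lambda>W. f (T \<union> W)) \<in> A" "alt U (\<lambda>W. f (insert x T \<union> W)) \<in> A"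
        using insert.prems insert.hyps by (auto intro!: insert.IH simp del: Un_insert_left)
      then show ?thesis
        using assms(4) by (simp add: alt_insert[OF insert.hyps])
    qed
  qed
  from this[of N "{}"] show ?thesis using assms by simp
qed

section \<open>Cubes of bounded degree as functions on finite subsets\<close>

text \<open>The vertices of a discrete cube are encoded by the subsets of a finite set \<open>N\<close>. For \<open>N = {..<n}\<close> this
  describes the \<open>n\<close>-cubes of \<open>D\<^sub>w\<close>; allowing arbitrary \<open>N\<close> makes faces cubes without relabelling.\<close>

definition scube :: "nat \<Rightarrow> nat set \<Rightarrow> (nat set \<Rightarrow> 'a::comm_ring_1) \<Rightarrow> bool" where
  "scube w N \<tau> \<longleftrightarrow> (\<forall>T U. T \<subseteq> N \<longrightarrow> U \<subseteq> N \<longrightarrow> T \<inter> U = {} \<longrightarrow> card U = Suc w \<longrightarrow>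
     alt U (\<lambda>W. \<tau> (T \<union> W)) = 0)"

lemma scubeD:
  "scube w N \<tau> \<Longrightarrow> T \<subseteq> N \<Longrightarrow> U \<subseteq> N \<Longrightarrow> T \<inter> U = {} \<Longrightarrow> card U = Suc w \<Longrightarrow> alt U (\<lambda>W. \<tau> (T \<union> W)) = 0"
  by (simp add: scube_def)

lemma scube_add: "scube w N \<tau> \<Longrightarrow> scube w N \<tau>' \<Longrightarrow> scube w N (\<lambda>W. \<tau> W + \<tau>' W)"
  by (simp add: scube_def alt_add)

lemma scube_mult_left: "scube w N \<tau> \<Longrightarrow> scube w N (\<lambda>W. s * \<tau> W)"
  by (simp add: scube_def alt_mult_left)

lemma scube_zero: "scube w N (\<lambda>_. 0)"
  by (simp add: scube_def)

text \<open>A face with \<open>w + 1\<close> directions has a direction outside \<open>S\<close>,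
  and the monomial does not change along it.\<close>

lemma scube_monomial:
  assumes "finite S" "card S \<le> w"
  shows "scube w N (\<lambda>W. if S \<subseteq> W then t else 0)"
  unfolding scube_def
proof (intro allI impI)
  fix T U :: "nat set" assume U: "card U = Suc w"
  then have "finite U" using card.infinite by fastforce
  have "\<not> U \<subseteq> S"
    using assms U by (metis card_mono not_less_eq_eq)
  then obtain x where "x \<in> U" "x \<notin> S" by auto
  then show "alt U (\<lambda>W. if S \<subseteq> T \<union> W then t else 0) = 0"
    using \<open>finite U\<close> by (intro alt_cancel[of U x]) auto
qed

lemma scube_const: "scube w N (\<lambda>_. t)"
  using scube_monomial[of "{}" w N t] by simp

lemma scube_face:
  assumes "scube w N \<tau>" "S \<subseteq> N" "M \<subseteq> N" "S \<inter> M = {}"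
  shows "scube w M (\<lambda>W. \<tau> (W \<union> S))"
  unfolding scube_def
proof (intro allI impI)
  fix T U assume "T \<subseteq> M" "U \<subseteq> M" "T \<inter> U = {}" "card U = Suc w"
  then have "alt U (\<lambda>W. \<tau> ((T \<union> S) \<union> W)) = 0"
    using assms by (intro scubeD[OF assms(1)]) auto
  then show "alt U (\<lambda>W. \<tau> ((T \<union> W) \<union> S)) = 0"
    by (simp add: Un_ac)
qed

text \<open>A face of the pullback either has a direction outside \<open>N\<close>, along which the
  function is constant, or is a face of the original cube.\<close>

lemma scube_pullback:
  assumes "scube w N \<tau>"
  shows "scube w M (\<lambda>W. \<tau> (W \<inter> N))"
  unfolding scube_def
proof (intro allI impI)
  fix T U assume TU: "T \<subseteq> M" "U \<subseteq> M" "T \<inter> U = {}" "card U = Suc w"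
  then have fin: "finite U" using card.infinite by fastforce
  show "alt U (\<lambda>W. \<tau> ((T \<union> W) \<inter> N)) = 0"
  proof (cases "U \<subseteq> N")
    case True
    then have "alt U (\<lambda>W. \<tau> ((T \<inter> N) \<union> W)) = 0"
      using TU by (intro scubeD[OF assms]) auto
    moreover have "alt U (\<lambda>W. \<tau> ((T \<union> W) \<inter> N)) = alt U (\<lambda>W. \<tau> ((T \<inter> N) \<union> W))"
      using True by (intro alt_cong arg_cong[of _ _ \<tau>]) auto
    ultimately show ?thesis by simp
  next
    case False
    then obtain x where "x \<in> U" "x \<notin> N" by auto
    then show ?thesis using fin by (intro alt_cancel[of U x]) auto
  qed
qed

text \<open>If \<open>S\<close> had more than \<open>w\<close> elements, a face with
  \<open>w + 1\<close> directions and top vertex \<open>S\<close> would have \<open>S\<close> as its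
  only vertex with nonzero value, and its alternating sum could not vanish.\<close>

lemma scube_support_card:
  assumes "scube w N \<tau>" "finite N" "S \<subseteq> N" "\<tau> S \<noteq> 0" "\<And>T. T \<subset> S \<Longrightarrow> \<tau> T = 0"
  shows "card S \<le> w"
proof (rule ccontr)
  assume "\<not> card S \<le> w"
  then obtain U where U: "U \<subseteq> S" "card U = Suc w"
    by (metis not_less_eq_eq obtain_subset_with_card_n)
  then have "finite U" using card.infinite by fastforce
  have "alt U (\<lambda>W. \<tau> ((S - U) \<union> W)) = 0"
    using U assms by (intro scubeD[OF assms(1)]) auto
  also have "alt U (\<lambda>W. \<tau> ((S - U) \<union> W)) = alt U (\<lambda>W. if U \<subseteq> W then \<tau> S else 0)"
  proof (rule alt_cong)
    fix W assume "W \<subseteq> U"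
    show "\<tau> ((S - U) \<union> W) = (if U \<subseteq> W then \<tau> S else 0)"
    proof (cases "U \<subseteq> W")
      case True
      with \<open>W \<subseteq> U\<close> U have "(S - U) \<union> W = S" by auto
      with True show ?thesis by simp
    next
      case False
      with \<open>W \<subseteq> U\<close> U have "(S - U) \<union> W \<subset> S" by auto
      with assms(5) False show ?thesis by simp
    qed
  qed
  also have "\<dots> = (-1) ^ card U * \<tau> S" using \<open>finite U\<close> by (rule alt_top)
  finally show False using assms(4)
    by (metis left_minus_one_mult_self mult_zero_right)
qed

text \<open>Cubes of \<open>D\<^sub>w\<close> are exactly the sums of monomials of degree at most \<open>w\<close>: subtract the monomial
  at a minimal point of the support and induct on the size of the up-set generated by the support.\<close>

lemma scube_induct [consumes 2, case_names zero add cong]: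
  assumes "finite N" "scube w N \<tau>"
    and zero: "Q (\<lambda>_. 0)"
    and add: "\<And>\<tau> S t. scube w N \<tau> \<Longrightarrow> Q \<tau> \<Longrightarrow> S \<subseteq> N \<Longrightarrow> card S \<le> w \<Longrightarrow>
      Q (\<lambda>W. \<tau> W + (if S \<subseteq> W then t else 0))"
    and cong: "\<And>\<tau> \<tau>'. Q \<tau> \<Longrightarrow> (\<And>W. W \<subseteq> N \<Longrightarrow> \<tau> W = \<tau>' W) \<Longrightarrow> Q \<tau>'"
  shows "Q \<tau>"
  using assms(2)
proof (induction "card {S \<in> Pow N. \<exists>T\<subseteq>S. \<tau> T \<noteq> 0}" arbitrary: \<tau> rule: less_induct)
  case less
  let ?up = "\<lambda>\<tau>. {S \<in> Pow N. \<exists>T\<subseteq>S. \<tau> T \<noteq> 0}"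
  show ?case
  proof (cases "?up \<tau> = {}")
    case True
    then show ?thesis by (intro cong[OF zero]) auto
  next
    case False
    then have ne: "{S \<in> Pow N. \<tau> S \<noteq> 0} \<noteq> {}" by auto
    have fin: "finite {S \<in> Pow N. \<tau> S \<noteq> 0}" using \<open>finite N\<close> by simp
    obtain S where S': "S \<in> {S \<in> Pow N. \<tau> S \<noteq> 0}"
      and minS: "\<forall>T\<in>{S \<in> Pow N. \<tau> S \<noteq> 0}. T \<le> S \<longrightarrow> S = T"
      using finite_has_minimal[OF fin ne] by (elim bexE)
    then have S: "S \<subseteq> N" "\<tau> S \<noteq> 0" by simp_all
    have below: "\<tau> T = 0" if "T \<subset> S" for T
    proof (rule ccontr)
      assume "\<tau> T \<noteq> 0"
      with that S(1) have "T \<in> {S \<in> Pow N. \<tau> S \<noteq> 0}" by auto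
      with minS that show False by auto
    qed
    have card: "card S \<le> w"
      using scube_support_card[OF less.prems \<open>finite N\<close> S below] .
    have finS: "finite S" using S \<open>finite N\<close> finite_subset by auto
    define \<tau>' where "\<tau>' = (\<lambda>W. \<tau> W + (if S \<subseteq> W then - \<tau> S else 0))"
    have cube': "scube w N \<tau>'"
      unfolding \<tau>'_def by (intro scube_add less.prems scube_monomial finS card)
    have "\<tau>' T = 0" if "T \<subseteq> S" for T
      using that below[of T] by (cases "T = S") (auto simp: \<tau>'_def)
    then have "S \<notin> ?up \<tau>'" by blast
    moreover have "S \<in> ?up \<tau>" using S by auto
    \<comment> \<open>Subtracting the monomial can create new nonzero values, but only above
      \<open>S\<close>, where the up-set of \<open>\<tau>\<close> already reaches. The support
      itself need not shrink, which is why the up-set is measured.\<close>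
    moreover have "?up \<tau>' \<subseteq> ?up \<tau>"
    proof (rule subsetI)
      fix R assume "R \<in> ?up \<tau>'"
      then obtain T where T: "R \<subseteq> N" "T \<subseteq> R" "\<tau>' T \<noteq> 0" by blast
      show "R \<in> ?up \<tau>"
      proof (cases "S \<subseteq> T")
        case True
        with T S(2) show ?thesis by blast
      next
        case False
        with T have "\<tau> T \<noteq> 0" by (simp add: \<tau>'_def)
        with T show ?thesis by blast
      qed
    qed
    ultimately have "?up \<tau>' \<subset> ?up \<tau>" by blast
    then have "card (?up \<tau>') < card (?up \<tau>)"
      using \<open>finite N\<close> by (intro psubset_card_mono) auto
    then have "Q \<tau>'" using less.hyps cube' by blast
    from add[OF cube' this S(1) card, of "\<tau> S"] show ?thesis
      by (rule cong) (auto simp: \<tau>'_def)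
  qed
qed

section \<open>Polynomial maps on integer lattices\<close>

text \<open>These are the cubes of a product of copies of the nilspaces
  \<open>D\<^sub>w(\<int>)\<close>, one for each coordinate in \<open>I\<close>. Setting the other
  coordinates to 0 makes a cube for \<open>I\<close> also a cube for
  \<open>insert e I\<close>.\<close>

definition icube :: "('i \<Rightarrow> nat) \<Rightarrow> 'i set \<Rightarrow> nat set \<Rightarrow> (nat set \<Rightarrow> 'i \<Rightarrow> int) \<Rightarrow> bool" where
  "icube w I N c \<longleftrightarrow> (\<forall>j\<in>I. scube (w j) N (\<lambda>W. c W j)) \<and> (\<forall>W j. j \<notin> I \<longrightarrow> c W j = 0)"

lemma icube_face:
  assumes "icube w I N c" "S \<subseteq> N" "M \<subseteq> N" "S \<inter> M = {}"
  shows "icube w I M (\<lambda>W. c (W \<union> S))"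
  using assms by (auto simp: icube_def intro: scube_face[OF _ assms(2,3,4), of _ "\<lambda>W. c W _"])

definition step :: "'i \<Rightarrow> ('i \<Rightarrow> int) \<Rightarrow> 'i \<Rightarrow> int" where
  "step e x = x(e := x e + 1)"

text \<open>Discrete differentiation in a coordinate of weight \<open>w\<close> lowers the degree by \<open>w\<close>: the difference is
  the alternating sum over a \<open>w\<close>-dimensional cube that is displaced at its top vertex only.\<close>

lemma alt_difference_Ints:
  assumes f: "\<And>N c. finite N \<Longrightarrow> d \<le> card N \<Longrightarrow> icube w I N c \<Longrightarrow> alt N (\<lambda>W. f (c W)) \<in> \<int>"
    and "e \<in> I" "1 \<le> w e" "finite N" "d - w e \<le> card N" "icube w I N c"
  shows "alt N (\<lambda>W. f (step e (c W)) - f (c W) :: real) \<in> \<int>"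
proof -
  obtain M where M: "finite M" "card M = w e" "M \<inter> N = {}"
  proof -
    have "infinite (- N)" using \<open>finite N\<close> by simp
    then show ?thesis using infinite_arbitrarily_large[of "- N" "w e"] that by blast
  qed
  have "M \<noteq> {}" using M assms(3) by auto
  \<comment> \<open>The cube is made constant in the fresh directions \<open>M\<close> and then
    displaced over the top vertex of \<open>M\<close>. This adds to the coordinate \<open>e\<close>
    the monomial of \<open>M\<close>, whose degree \<open>w e\<close> is the largest one
    allowed.\<close>
  define c' where "c' = (\<lambda>W. if M \<subseteq> W then step e (c (W \<inter> N)) else c (W \<inter> N))"
  have "icube w I (N \<union> M) c'"
    unfolding icube_def
  proof (intro conjI allI impI ballI)
    fix j assume j: "j \<in> I"
    have p: "scube (w j) (N \<union> M) (\<lambda>W. c (W \<inter> N) j)"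
      using \<open>icube w I N c\<close> j scube_pullback[of "w j" N "\<lambda>W. c W j"] by (auto simp: icube_def)
    show "scube (w j) (N \<union> M) (\<lambda>W. c' W j)"
    proof (cases "j = e")
      case True
      have "scube (w j) (N \<union> M) (\<lambda>W. c (W \<inter> N) j + (if M \<subseteq> W then 1 else 0))"
        using p M True by (intro scube_add scube_monomial) auto
      moreover have "(\<lambda>W. c' W j) = (\<lambda>W. c (W \<inter> N) j + (if M \<subseteq> W then 1 else 0))"
        using True by (auto simp: c'_def step_def)
      ultimately show ?thesis by simp
    next
      case False
      then have "(\<lambda>W. c' W j) = (\<lambda>W. c (W \<inter> N) j)"
        by (auto simp: c'_def step_def)
      with p show ?thesis by simp
    qed
  next
    fix W j assume "j \<notin> I"
    then show "c' W j = 0"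
      using \<open>icube w I N c\<close> \<open>e \<in> I\<close> by (auto simp: c'_def step_def icube_def)
  qed
  \<comment> \<open>The subtraction in \<open>d - w e\<close> is truncated; if
    \<open>d < w e\<close>, the directions of \<open>M\<close> alone are enough.\<close>
  moreover have "d \<le> card (N \<union> M)"
    using M assms by (subst card_Un_disjoint) auto
  ultimately have "alt (N \<union> M) (\<lambda>W. f (c' W)) \<in> \<int>"
    using f \<open>finite N\<close> M by blast
  also have "alt (N \<union> M) (\<lambda>W. f (c' W)) = alt M (\<lambda>B. alt N (\<lambda>A. f (c' (A \<union> B))))"
    using M \<open>finite N\<close> by (intro alt_Un) auto
  \<comment> \<open>Every face parallel to \<open>N\<close> contributes the sum of \<open>f\<close>
    over \<open>c\<close>, which cancels because \<open>M\<close> is nonempty. Only the face at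
    \<open>B = M\<close> contributes the difference as well.\<close>
  also have "\<dots> = alt M (\<lambda>B. alt N (\<lambda>A. f (c A)) +
      (if M \<subseteq> B then alt N (\<lambda>W. f (step e (c W)) - f (c W)) else 0))"
  proof (rule alt_cong)
    fix B assume B: "B \<subseteq> M"
    have "alt N (\<lambda>A. f (c' (A \<union> B))) = alt N (\<lambda>A. f (c A) + (if M \<subseteq> B then f (step e (c A)) - f (c A) else 0))"
    proof (rule alt_cong)
      fix A assume "A \<subseteq> N"
      then have "M \<subseteq> A \<union> B \<longleftrightarrow> M \<subseteq> B" "(A \<union> B) \<inter> N = A"
        using B M by blast+
      then show "f (c' (A \<union> B)) = f (c A) + (if M \<subseteq> B then f (step e (c A)) - f (c A) else 0)"
        by (simp add: c'_def)
    qed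
    then show "alt N (\<lambda>A. f (c' (A \<union> B))) = alt N (\<lambda>A. f (c A)) +
      (if M \<subseteq> B then alt N (\<lambda>W. f (step e (c W)) - f (c W)) else 0)"
      by (simp add: alt_add)
  qed
  also have "\<dots> = (-1) ^ card M * alt N (\<lambda>W. f (step e (c W)) - f (c W))"
    using M \<open>M \<noteq> {}\<close> by (simp add: alt_add alt_const alt_top)
  finally show ?thesis
    by (cases "even (card M)") simp_all
qed

text \<open>The coordinate \<open>e\<close> of a cube arises from 0 by adding monomials. Adding 1
  above \<open>S\<close> changes the alternating sum by that of the difference over the face of
  vertices containing \<open>S\<close>, up to sign. Since \<open>card S \<le> w e\<close>, this face
  has at least \<open>d - w e\<close> directions and \<open>diff\<close> applies.\<close>

lemma alt_summation:
  fixes f :: "('i \<Rightarrow> int) \<Rightarrow> real"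
  assumes e: "e \<notin> I"
    and base: "\<And>N c. finite N \<Longrightarrow> d \<le> card N \<Longrightarrow> icube w I N c \<Longrightarrow> alt N (\<lambda>W. f (c W)) = 0"
    and diff: "\<And>N c. finite N \<Longrightarrow> d - w e \<le> card N \<Longrightarrow> icube w (insert e I) N c \<Longrightarrow>
      alt N (\<lambda>W. f (step e (c W)) - f (c W)) = 0"
    and N: "finite N" "d \<le> card N" and c: "icube w (insert e I) N c"
  shows "alt N (\<lambda>W. f (c W)) = 0"
proof -
  \<comment> \<open>\<open>c0 \<tau>\<close> is the cube with its coordinate \<open>e\<close>
    exchanged for \<open>\<tau>\<close>. For \<open>\<tau> = 0\<close> it lies in the hyperplane
    covered by \<open>base\<close>.\<close>
  define c0 where "c0 = (\<lambda>\<tau> W. (c W)(e := \<tau> W))"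
  define Q where "Q = (\<lambda>\<tau>. alt N (\<lambda>W. f (c0 \<tau> W)) = 0)"
  have cube: "icube w (insert e I) N (c0 \<tau>)" if "scube (w e) N \<tau>" for \<tau>
    unfolding icube_def c0_def
  proof (intro conjI ballI allI impI)
    fix j assume "j \<in> insert e I"
    then show "scube (w j) N (\<lambda>W. ((c W)(e := \<tau> W)) j)"
      using c that by (cases "j = e") (auto simp: icube_def)
  qed (use c in \<open>auto simp: icube_def\<close>)
  have shift: "Q (\<lambda>W. \<tau> W + (if S \<subseteq> W then 1 else 0)) \<longleftrightarrow> Q \<tau>"
    if \<tau>: "scube (w e) N \<tau>" and S: "S \<subseteq> N" "card S \<le> w e" for \<tau> S
  proof -
    let ?g = "\<lambda>W. f (step e (c0 \<tau> W)) - f (c0 \<tau> W)"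
    have finS: "finite S" using S N finite_subset by auto
    have "d - w e \<le> card (N - S)"
      using S N finS by (simp add: card_Diff_subset)
    moreover have "icube w (insert e I) (N - S) (\<lambda>W. c0 \<tau> (W \<union> S))"
      using cube[OF \<tau>] S by (intro icube_face[of w _ N]) auto
    ultimately have *: "alt (N - S) (\<lambda>A. ?g (A \<union> S)) = 0"
      using diff N by auto
    have "alt N (\<lambda>W. f (c0 (\<lambda>W. \<tau> W + (if S \<subseteq> W then 1 else 0)) W)) =
        alt N (\<lambda>W. f (c0 \<tau> W) + (if S \<subseteq> W then ?g W else 0))"
      by (rule alt_cong) (auto simp: c0_def step_def)
    also have "\<dots> = alt N (\<lambda>W. f (c0 \<tau> W)) + alt N (\<lambda>W. if S \<subseteq> W then ?g W else 0)"
      by (rule alt_add)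
    also have "alt N (\<lambda>W. if S \<subseteq> W then ?g W else 0) =
        alt S (\<lambda>B. alt (N - S) (\<lambda>A. if S \<subseteq> A \<union> B then ?g (A \<union> B) else 0))"
      using alt_Un[of "N - S" S "\<lambda>W. if S \<subseteq> W then ?g W else 0"] S N finS by (auto simp: Un_absorb2)
    also have "\<dots> = alt S (\<lambda>B. if S \<subseteq> B then alt (N - S) (\<lambda>A. ?g (A \<union> S)) else 0)"
    proof (rule alt_cong)
      fix B assume B: "B \<subseteq> S"
      show "alt (N - S) (\<lambda>A. if S \<subseteq> A \<union> B then ?g (A \<union> B) else 0) =
        (if S \<subseteq> B then alt (N - S) (\<lambda>A. ?g (A \<union> S)) else 0)"
      proof (cases "S \<subseteq> B")
        case True
        with B have "B = S" by auto
        then show ?thesis by simp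
      next
        case False
        then have "alt (N - S) (\<lambda>A. if S \<subseteq> A \<union> B then ?g (A \<union> B) else 0) = alt (N - S) (\<lambda>_. 0)"
          by (intro alt_cong) auto
        with False show ?thesis by simp
      qed
    qed
    also have "\<dots> = 0" by (simp only: * if_cancel alt_zero)
    finally show ?thesis by (simp add: Q_def)
  qed
  have "Q (\<lambda>W. c W e)"
  proof (rule scube_induct[of N "w e"])
    show "finite N" by fact
    show "scube (w e) N (\<lambda>W. c W e)" using c by (simp add: icube_def)
    have "icube w I N (c0 (\<lambda>_. 0))"
      unfolding icube_def c0_def
    proof (intro conjI ballI allI impI)
      fix j assume "j \<in> I"
      then have "j \<noteq> e" using e by auto
      then show "scube (w j) N (\<lambda>W. ((c W)(e := 0)) j)"
        using c \<open>j \<in> I\<close> by (auto simp: icube_def)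
    qed (use c in \<open>auto simp: icube_def\<close>)
    then show "Q (\<lambda>_. 0)"
      unfolding Q_def using base N by blast
  next
    fix \<tau> S and t :: int
    assume \<tau>: "scube (w e) N \<tau>" "Q \<tau>" and S: "S \<subseteq> N" "card S \<le> w e"
    have finS: "finite S" using S N finite_subset by auto
    define \<tau>' where "\<tau>' = (\<lambda>u W. \<tau> W + (if S \<subseteq> W then u else (0::int)))"
    have cube': "scube (w e) N (\<tau>' u)" for u
      unfolding \<tau>'_def by (intro scube_add \<tau> scube_monomial finS S)
    have suc: "Q (\<tau>' (u + 1)) \<longleftrightarrow> Q (\<tau>' u)" for u
    proof -
      have "\<tau>' (u + 1) = (\<lambda>W. \<tau>' u W + (if S \<subseteq> W then 1 else 0))"
        by (auto simp: \<tau>'_def)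
      with shift[OF cube' S, of u] show ?thesis by simp
    qed
    \<comment> \<open>As \<open>shift\<close> is an equivalence, unit steps up and down from 0 reach
      every integer coefficient \<open>t\<close>.\<close>
    have "Q (\<tau>' t)"
    proof (induction t rule: int_induct[of _ 0])
      case base
      then show ?case using \<tau> by (simp add: \<tau>'_def)
    next
      case (step1 i)
      then show ?case using suc by blast
    next
      case (step2 i)
      then show ?case using suc[of "i - 1"] by simp
    qed
    then show "Q (\<lambda>W. \<tau> W + (if S \<subseteq> W then t else 0))" by (simp add: \<tau>'_def)
  next
    fix \<tau> \<tau>' assume "Q \<tau>" and eq: "\<And>W. W \<subseteq> N \<Longrightarrow> \<tau> W = \<tau>' W"
    moreover have "alt N (\<lambda>W. f (c0 \<tau> W)) = alt N (\<lambda>W. f (c0 \<tau>' W))"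
      by (rule alt_cong) (simp add: c0_def eq)
    ultimately show "Q \<tau>'" by (simp add: Q_def)
  qed
  then show ?thesis by (simp add: Q_def c0_def)
qed

lemma Ints_iff_of_diff:
  fixes p q :: "'a::ring_1"
  assumes "p - q \<in> \<int>"
  shows "p \<in> \<int> \<longleftrightarrow> q \<in> \<int>"
  using Ints_add[OF assms, of q] Ints_diff[OF _ assms, of p] by auto

text \<open>Summation inverts the difference operator: forwards over \<open>0, ..., u - 1\<close>,
  and for negative \<open>u\<close> backwards over \<open>-1, ..., u\<close>.\<close>

lemma int_summation_exists:
  fixes D :: "int \<Rightarrow> real"
  shows "\<exists>F. F 0 = y \<and> (\<forall>u. F (u + 1) - F u = D u)"
proof -
  define F where "F = (\<lambda>u. if 0 \<le> u then y + (\<Sum>k<nat u. D (int k)) else y - (\<Sum>k<nat (- u). D (- 1 - int k)))"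
  have "F (u + 1) - F u = D u" for u
  proof (cases "0 \<le> u")
    case True
    then have "nat (u + 1) = Suc (nat u)" by simp
    with True show ?thesis by (simp add: F_def)
  next
    case False
    then have "nat (- u) = Suc (nat (- (u + 1)))" by simp
    \<comment> \<open>At \<open>u = -1\<close> the two branches of \<open>F\<close> meet, as
      \<open>u + 1\<close> already falls under the first one.\<close>
    with False show ?thesis by (cases "u = -1") (auto simp: F_def)
  qed
  moreover have "F 0 = y" by (simp add: F_def)
  ultimately show ?thesis by blast
qed

text \<open>The outer induction on \<open>I\<close> supplies a corrected function \<open>g\<close>
  on the hyperplane where the coordinate \<open>e\<close> is 0. The inner induction on
  \<open>d\<close> supplies a corrected difference \<open>D\<close>; its bound drops because
  \<open>w e\<close> is positive. The function summed up from \<open>g\<close> by \<open>D\<close>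
  has vanishing sums by \<open>alt_summation\<close>.\<close>

lemma integral_polynomial_lift:
  fixes f :: "('i \<Rightarrow> int) \<Rightarrow> real"
  assumes "finite I" "\<And>j. j \<in> I \<Longrightarrow> 1 \<le> w j"
    and "\<And>N c. finite N \<Longrightarrow> d \<le> card N \<Longrightarrow> icube w I N c \<Longrightarrow> alt N (\<lambda>W. f (c W)) \<in> \<int>"
  shows "\<exists>f'. (\<forall>x. (\<forall>j. j \<notin> I \<longrightarrow> x j = 0) \<longrightarrow> f' x - f x \<in> \<int>) \<and>
    (\<forall>N c. finite N \<longrightarrow> d \<le> card N \<longrightarrow> icube w I N c \<longrightarrow> alt N (\<lambda>W. f' (c W)) = 0)"
  using assms
proof (induction I arbitrary: d f rule: finite_induct)
  case empty
  have c: "c = (\<lambda>_ _. 0)" if "icube w {} N c" for N c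
    using that by (auto simp: icube_def)
  have cube0: "icube w {} {} (\<lambda>_ _. 0)" by (simp add: icube_def)
  \<comment> \<open>There is a single point. For \<open>d = 0\<close> the cube with
    \<open>N = {}\<close> shows that \<open>f\<close> is an integer there, so 0 is a correction; for
    \<open>d > 0\<close> every sum is that of a constant over a nonempty set of directions.\<close>
  show ?case
  proof (cases "d = 0")
    case True
    then have f0: "f (\<lambda>_. 0) \<in> \<int>" using empty(2)[OF _ _ cube0] by simp
    have "f x \<in> \<int>" if "\<forall>j. j \<notin> {} \<longrightarrow> x j = 0" for x
    proof -
      have "x = (\<lambda>_. 0)" using that by auto
      with f0 show ?thesis by simp
    qed
    then show ?thesis by (intro exI[of _ "\<lambda>_. 0"]) auto
  next
    case False
    have "alt N (\<lambda>W. f (c W)) = 0" if "finite N" "d \<le> card N" "icube w {} N c" for N c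
      using that False by (subst c[OF that(3)]) (auto intro!: alt_const)
    then show ?thesis
      by (intro exI[of _ f]) simp
  qed
next
  case (insert e I)
  note outer = insert.IH
  have we: "1 \<le> w e" using insert.prems by auto
  show ?case using insert.prems(2)
  proof (induction d arbitrary: f rule: less_induct)
    case (less d)
    show ?case
    proof (cases "d = 0")
      case True
      \<comment> \<open>Each point is a cube with \<open>N = {}\<close>, so \<open>f\<close> is
        integer-valued and the zero function is a correction.\<close>
      have "f x \<in> \<int>" if "\<forall>j. j \<notin> insert e I \<longrightarrow> x j = 0" for x
      proof -
        have "icube w (insert e I) {} (\<lambda>_. x)"
          using that by (auto simp: icube_def scube_const)
        then show ?thesis using less.prems[of "{}" "\<lambda>_. x"] True by simp
      qed
      then show ?thesis by (intro exI[of _ "\<lambda>_. 0"]) auto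
    next
      case False
      then have lt: "d - w e < d" using we by simp
      have "\<exists>D. (\<forall>x. (\<forall>j. j \<notin> insert e I \<longrightarrow> x j = 0) \<longrightarrow> D x - (f (step e x) - f x) \<in> \<int>) \<and>
        (\<forall>N c. finite N \<longrightarrow> d - w e \<le> card N \<longrightarrow> icube w (insert e I) N c \<longrightarrow> alt N (\<lambda>W. D (c W)) = 0)"
      proof (rule less.IH[OF lt])
        fix N c assume "finite N" "d - w e \<le> card N" "icube w (insert e I) N c"
        with less.prems we show "alt N (\<lambda>W. f (step e (c W)) - f (c W)) \<in> \<int>"
          by (intro alt_difference_Ints[where d = d and f = f and I = "insert e I" and w = w]) auto
      qed
      then obtain D where
        D: "\<And>x. (\<forall>j. j \<notin> insert e I \<longrightarrow> x j = 0) \<Longrightarrow> D x - (f (step e x) - f x) \<in> \<int>"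
        and D0: "\<And>N c. finite N \<Longrightarrow> d - w e \<le> card N \<Longrightarrow> icube w (insert e I) N c \<Longrightarrow> alt N (\<lambda>W. D (c W)) = 0"
        by blast
      have "\<exists>g. (\<forall>x. (\<forall>j. j \<notin> I \<longrightarrow> x j = 0) \<longrightarrow> g x - f x \<in> \<int>) \<and>
        (\<forall>N c. finite N \<longrightarrow> d \<le> card N \<longrightarrow> icube w I N c \<longrightarrow> alt N (\<lambda>W. g (c W)) = 0)"
      proof (rule outer)
        fix N c assume "finite N" "d \<le> card N" "icube w I N c"
        moreover from this(3) have "icube w (insert e I) N c"
          using insert.hyps by (auto simp: icube_def scube_zero)
        ultimately show "alt N (\<lambda>W. f (c W)) \<in> \<int>"
          by (intro less.prems)
      qed (use insert.prems in auto)
      then obtain g where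
        g: "\<And>x. (\<forall>j. j \<notin> I \<longrightarrow> x j = 0) \<Longrightarrow> g x - f x \<in> \<int>"
        and g0: "\<And>N c. finite N \<Longrightarrow> d \<le> card N \<Longrightarrow> icube w I N c \<Longrightarrow> alt N (\<lambda>W. g (c W)) = 0"
        by blast
      have "\<forall>x. \<exists>F. F 0 = g (x(e := 0)) \<and> (\<forall>u. F (u + 1) - F u = D (x(e := u)))"
        by (intro allI int_summation_exists)
      from choice[OF this]
      obtain F where F: "\<And>x. F x 0 = g (x(e := 0))" "\<And>x u. F x (u + 1) - F x u = D (x(e := u))"
        by blast
      \<comment> \<open>The function \<open>F\<close> was chosen for each \<open>x\<close>
        separately; evaluating at \<open>x(e := 0)\<close> selects one choice for the whole line in
        direction \<open>e\<close>.\<close>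
      define f' where "f' = (\<lambda>x. F (x(e := 0)) (x e))"
      have f'_step: "f' (step e x) - f' x = D x" for x
        using F(2)[of "x(e := 0)" "x e"] by (simp add: f'_def step_def)
      have f'_base: "f' x = g x" if "x e = 0" for x
      proof -
        have "x(e := 0) = x" using that by auto
        then show ?thesis using F(1)[of x] that by (simp add: f'_def)
      qed
      have "alt N (\<lambda>W. f' (c W)) = 0" if "finite N" "d \<le> card N" "icube w (insert e I) N c" for N c
      proof (rule alt_summation[OF insert.hyps(2) _ _ that])
        fix N c assume "finite N" "d \<le> card N" "icube w I N c"
        moreover from this have "c W e = 0" for W using insert.hyps by (simp add: icube_def)
        ultimately show "alt N (\<lambda>W. f' (c W)) = 0" using g0 f'_base by simp
      next
        fix N c assume "finite N" "d - w e \<le> card N" "icube w (insert e I) N c"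
        then show "alt N (\<lambda>W. f' (step e (c W)) - f' (c W)) = 0"
          using D0 f'_step by simp
      qed
      moreover have "f' x - f x \<in> \<int>" if x: "\<forall>j. j \<notin> insert e I \<longrightarrow> x j = 0" for x
      proof -
        \<comment> \<open>The congruence holds on the hyperplane because of \<open>g\<close>, and it
          passes along the line in direction \<open>e\<close> because \<open>D\<close> is congruent
          to the difference of \<open>f\<close>.\<close>
        define p where "p = (\<lambda>u. f' (x(e := u)) - f (x(e := u)))"
        have suc: "p (u + 1) \<in> \<int> \<longleftrightarrow> p u \<in> \<int>" for u
        proof (rule Ints_iff_of_diff)
          have "D (x(e := u)) - (f (step e (x(e := u))) - f (x(e := u))) \<in> \<int>"
            by (rule D) (use x in simp)
          then have "f' (step e (x(e := u))) - f' (x(e := u)) - (f (step e (x(e := u))) - f (x(e := u))) \<in> \<int>"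
            by (simp only: f'_step)
          moreover have "step e (x(e := u)) = x(e := u + 1)" by (simp add: step_def)
          moreover have "p (u + 1) - p u =
              f' (x(e := u + 1)) - f' (x(e := u)) - (f (x(e := u + 1)) - f (x(e := u)))"
            by (simp add: p_def)
          ultimately show "p (u + 1) - p u \<in> \<int>"
            by metis
        qed
        have "p u \<in> \<int>" for u
        proof (induction u rule: int_induct[of _ 0])
          case base
          have "g (x(e := 0)) - f (x(e := 0)) \<in> \<int>"
            by (rule g) (use x in simp)
          moreover have "f' (x(e := 0)) = g (x(e := 0))" by (rule f'_base) simp
          ultimately show ?case by (simp only: p_def)
        next
          case (step1 i)
          then show ?case using suc by blast
        next
          case (step2 i)
          then show ?case using suc[of "i - 1"] by simp
        qed
        from this[of "x e"] show ?thesis by (simp add: p_def)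
      qed
      ultimately show ?thesis by blast
    qed
  qed
qed

section \<open>Comparison with discrete cube morphisms\<close>

lemma alt_reindex:
  assumes "bij_betw g A U"
  shows "alt U f = alt A (\<lambda>S. f (g ` S))"
  unfolding alt_def
proof (rule sum.reindex_bij_betw[symmetric, THEN trans])
  show "bij_betw ((`) g) (Pow A) (Pow U)"
    by (rule bij_betw_Pow[OF assms])
  show "(\<Sum>S\<in>Pow A. (-1) ^ card (g ` S) * f (g ` S)) = (\<Sum>S\<in>Pow A. (-1) ^ card S * f (g ` S))"
  proof (intro sum.cong refl)
    fix S assume "S \<in> Pow A"
    then have "card (g ` S) = card S"
      using assms by (auto simp: bij_betw_def intro!: card_image intro: inj_on_subset)
    then show "(-1) ^ card (g ` S) * f (g ` S) = (-1) ^ card S * f (g ` S)" by simp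
  qed
qed

definition vertex :: "nat \<Rightarrow> nat set \<Rightarrow> nat \<Rightarrow> nat" where
  "vertex n S = (\<lambda>j\<in>{..<n}. if j \<in> S then 1 else 0)"

definition ones :: "nat \<Rightarrow> (nat \<Rightarrow> nat) \<Rightarrow> nat set" where
  "ones n v = {j. j < n \<and> v j = 1}"

lemma vertex_in_vertices [simp]: "vertex n S \<in> vertices n"
  by (auto simp: vertex_def vertices_def)

lemma ones_subset: "ones n v \<subseteq> {..<n}"
  by (auto simp: ones_def)

lemma ones_vertex [simp]: "ones n (vertex n S) = S \<inter> {..<n}"
  by (auto simp: ones_def vertex_def)

lemma vertex_ones: "v \<in> vertices n \<Longrightarrow> vertex n (ones n v) = v"
  by (rule PiE_ext[of _ "{..<n}" "\<lambda>_. {0, 1}"]) (auto simp: vertex_def ones_def vertices_def PiE_iff)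

lemma bij_betw_vertex: "bij_betw (vertex n) (Pow {..<n}) (vertices n)"
  by (rule bij_betw_byWitness[where f' = "ones n"])
    (use ones_subset in \<open>auto simp: vertex_ones\<close>)

lemma finite_vertices: "finite (vertices n)"
  using bij_betw_vertex[of n] bij_betw_finite by auto

lemma sum_vertex: "S \<subseteq> {..<n} \<Longrightarrow> (\<Sum>j<n. vertex n S j) = card S"
proof -
  assume S: "S \<subseteq> {..<n}"
  have "(\<Sum>j<n. vertex n S j) = (\<Sum>j<n. if j \<in> S then 1 else 0)"
    by (rule sum.cong) (auto simp: vertex_def)
  also have "\<dots> = card ({..<n} \<inter> S)" by (simp flip: sum.inter_restrict)
  finally show ?thesis using S by (simp add: Int_absorb1)
qed

text \<open>This links the sums in the definition of \<open>D_nilspace\<close> to alternating sums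
  over subsets.\<close>

lemma sum_vertices_eq_alt:
  "(\<Sum>v\<in>vertices n. (-1) ^ (\<Sum>j<n. v j) * f v) = alt {..<n} (\<lambda>S. f (vertex n S))"
  unfolding alt_def
  by (subst sum.reindex_bij_betw[OF bij_betw_vertex, symmetric]) (auto intro!: sum.cong simp: sum_vertex)

text \<open>Coordinates in \<open>T\<close> are fixed at 1, those in \<open>U\<close> copy the
  source coordinates through an enumeration \<open>g\<close>, and the remaining ones are fixed at
  0.\<close>

lemma exists_face_morphism:
  assumes "T \<subseteq> {..<n}" "U \<subseteq> {..<n}" "T \<inter> U = {}" "card U = m"
  shows "\<exists>\<rho>\<in>discrete_cube_morphisms m n. \<exists>g. bij_betw g {..<m} U \<and>
    (\<forall>S\<subseteq>{..<m}. \<rho> (vertex m S) = vertex n (T \<union> g ` S))"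
proof -
  have "finite U" using finite_subset[OF assms(2)] by simp
  then obtain g where g: "bij_betw g {..<m} U"
    using assms(4) ex_bij_betw_nat_finite[of U] by (auto simp: atLeast0LessThan)
  define \<rho> where "\<rho> = (\<lambda>v\<in>vertices m. vertex n (T \<union> g ` ones m v))"
  have "\<rho> \<in> discrete_cube_morphisms m n"
    unfolding discrete_cube_morphisms_def
  proof (intro CollectI conjI allI impI)
    show "\<rho> \<in> vertices m \<rightarrow>\<^sub>E vertices n" by (auto simp: \<rho>_def)
    fix i assume i: "i < n"
    consider "i \<in> T" | "i \<in> U" | "i \<notin> T \<union> U" by blast
    then show "(\<forall>v\<in>vertices m. \<rho> v i = 0) \<or> (\<forall>v\<in>vertices m. \<rho> v i = 1) \<or>
        (\<exists>j<m. \<forall>v\<in>vertices m. \<rho> v i = v j) \<or> (\<exists>j<m. \<forall>v\<in>vertices m. \<rho> v i = 1 - v j)"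
    proof cases
      case 1
      then have "\<forall>v\<in>vertices m. \<rho> v i = 1" using i by (simp add: \<rho>_def vertex_def)
      then show ?thesis by blast
    next
      case 2
      then obtain j where j: "j < m" "g j = i"
        using g by (auto simp: bij_betw_def)
      have "\<rho> v i = v j" if v: "v \<in> vertices m" for v
      proof -
        have "i \<in> g ` ones m v \<longleftrightarrow> j \<in> ones m v"
          using j g by (auto simp: bij_betw_def inj_on_def ones_def)
        moreover have "v j \<in> {0, 1}" using v j by (auto simp: vertices_def)
        ultimately show ?thesis
          using 2 assms(3) i j v by (auto simp: \<rho>_def vertex_def ones_def)
      qed
      then show ?thesis using j by blast
    next
      case 3
      then have "i \<notin> g ` ones m v" for v
        using g by (auto simp: bij_betw_def ones_def)
      then have "\<forall>v\<in>vertices m. \<rho> v i = 0" using 3 i by (simp add: \<rho>_def vertex_def)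
      then show ?thesis by blast
    qed
  qed
  moreover have "\<forall>S\<subseteq>{..<m}. \<rho> (vertex m S) = vertex n (T \<union> g ` S)"
    by (simp add: \<rho>_def Int_absorb2)
  ultimately show ?thesis using g by blast
qed

lemma alt_face:
  assumes "bij_betw g {..<m} U" "\<forall>S\<subseteq>{..<m}. \<rho> (vertex m S) = vertex n (T \<union> g ` S)"
  shows "alt {..<m} (\<lambda>S. f (\<rho> (vertex m S))) = alt U (\<lambda>W. f (vertex n (T \<union> W)))"
  unfolding alt_reindex[OF assms(1)]
  by (rule alt_cong) (use assms(2) in auto)

text \<open>This is the cube condition of \<open>D_nilspace\<close> for a single integer or real
  coordinate, in additive notation.\<close>

definition scalar_cube :: "nat \<Rightarrow> nat \<Rightarrow> ((nat \<Rightarrow> nat) \<Rightarrow> 'a::comm_ring_1) \<Rightarrow> bool" where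
  "scalar_cube w n c \<longleftrightarrow> (\<forall>\<rho>\<in>discrete_cube_morphisms (w + 1) n.
     (\<Sum>v\<in>vertices (w + 1). (-1) ^ (\<Sum>j<w + 1. v j) * c (\<rho> v)) = 0)"

lemma discrete_cube_morphism_vertices:
  "\<rho> \<in> discrete_cube_morphisms m n \<Longrightarrow> v \<in> vertices m \<Longrightarrow> \<rho> v \<in> vertices n"
  by (auto simp: discrete_cube_morphisms_def)

lemma scalar_cube_cong:
  assumes "\<And>v. v \<in> vertices n \<Longrightarrow> c v = c' v"
  shows "scalar_cube w n c = scalar_cube w n c'"
  unfolding scalar_cube_def
  using assms discrete_cube_morphism_vertices by (intro ball_cong refl arg_cong2[of _ _ _ _ "(=)"] sum.cong) auto

lemma scalar_cube_imp_scube: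
  assumes "scalar_cube w n c"
  shows "scube w {..<n} (\<lambda>S. c (vertex n S))"
  unfolding scube_def
proof (intro allI impI)
  fix T U assume TU: "T \<subseteq> {..<n}" "U \<subseteq> {..<n}" "T \<inter> U = {}" "card U = Suc w"
  from exists_face_morphism[OF this] obtain \<rho> g where \<rho>: "\<rho> \<in> discrete_cube_morphisms (w + 1) n"
    "bij_betw g {..<Suc w} U" "\<forall>S\<subseteq>{..<Suc w}. \<rho> (vertex (Suc w) S) = vertex n (T \<union> g ` S)"
    by auto
  have "alt {..<Suc w} (\<lambda>S. c (\<rho> (vertex (Suc w) S))) = 0"
    using assms \<rho>(1) unfolding scalar_cube_def sum_vertices_eq_alt by simp
  then show "alt U (\<lambda>W. c (vertex n (T \<union> W))) = 0"
    using alt_face[OF \<rho>(2,3), where f = c] by simp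
qed

text \<open>Each coordinate of \<open>\<rho> v\<close> involves at most one coordinate of \<open>v\<close>, so a monomial of degree
  at most \<open>w\<close> misses one of the \<open>w + 1\<close> coordinates of \<open>v\<close>.\<close>

lemma scalar_cube_monomial:
  assumes "S \<subseteq> {..<n}" "card S \<le> w"
  shows "scalar_cube w n (\<lambda>v. if S \<subseteq> ones n v then t else 0)"
  unfolding scalar_cube_def sum_vertices_eq_alt
proof
  fix \<rho> assume \<rho>: "\<rho> \<in> discrete_cube_morphisms (w + 1) n"
  have "finite S" using assms finite_subset by auto
  \<comment> \<open>\<open>J i\<close> is the source coordinate that determines the coordinate
    \<open>i\<close> of \<open>\<rho> v\<close>; for a constant coordinate any value will
    do.\<close>
  have "\<exists>j. \<forall>v\<in>vertices (w + 1). \<forall>v'\<in>vertices (w + 1). v j = v' j \<longrightarrow> \<rho> v i = \<rho> v' i" if "i < n" for i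
    using \<rho> that unfolding discrete_cube_morphisms_def by (smt (verit, ccfv_threshold) mem_Collect_eq)
  then obtain J where J: "\<And>i v v'. i < n \<Longrightarrow> v \<in> vertices (w + 1) \<Longrightarrow> v' \<in> vertices (w + 1) \<Longrightarrow>
      v (J i) = v' (J i) \<Longrightarrow> \<rho> v i = \<rho> v' i"
    by metis
  have "card (J ` S) < card {..<w + 1}"
    using card_image_le[OF \<open>finite S\<close>, of J] assms(2) by simp
  then have "\<not> {..<w + 1} \<subseteq> J ` S"
    using \<open>finite S\<close> by (meson card_mono finite_imageI leD)
  then obtain x where x: "x < w + 1" "x \<notin> J ` S" by auto
  show "alt {..<w + 1} (\<lambda>W. if S \<subseteq> ones n (\<rho> (vertex (w + 1) W)) then t else 0) = 0"
  proof (rule alt_cancel[of _ x])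
    fix W
    have "\<rho> (vertex (w + 1) (insert x W)) i = \<rho> (vertex (w + 1) W) i" if "i \<in> S" for i
    proof (rule J)
      show "i < n" using that assms by auto
      have "J i \<noteq> x" using that x by auto
      then show "vertex (w + 1) (insert x W) (J i) = vertex (w + 1) W (J i)"
        by (auto simp: vertex_def)
    qed auto
    then have "S \<subseteq> ones n (\<rho> (vertex (w + 1) (insert x W))) \<longleftrightarrow> S \<subseteq> ones n (\<rho> (vertex (w + 1) W))"
      by (auto simp: ones_def subset_iff)
    then show "(if S \<subseteq> ones n (\<rho> (vertex (w + 1) (insert x W))) then t else 0) =
        (if S \<subseteq> ones n (\<rho> (vertex (w + 1) W)) then t else 0)"
      by simp
  qed (use x in auto)
qed

text \<open>Discrete-cube morphisms may also repeat or reflect coordinates, so more is claimed than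
  vanishing on faces. The claim is linear in \<open>\<tau>\<close>, and \<open>scube_induct\<close>
  reduces it to monomials.\<close>

lemma scube_imp_scalar_cube:
  assumes "scube w {..<n} \<tau>"
  shows "scalar_cube w n (\<lambda>v. \<tau> (ones n v))"
  using finite_lessThan[of n] assms
proof (induction rule: scube_induct)
  case zero
  then show ?case by (simp add: scalar_cube_def)
next
  case (add \<tau> S t)
  then show ?case
    using scalar_cube_monomial[of S n w t]
    by (simp add: scalar_cube_def sum.distrib distrib_left)
next
  case (cong \<tau> \<tau>')
  then show ?case
    using scalar_cube_cong[of n "\<lambda>v. \<tau> (ones n v)" "\<lambda>v. \<tau>' (ones n v)"] ones_subset by auto
qed

lemma scalar_cube_iff_scube:
  "scalar_cube w n c \<longleftrightarrow> scube w {..<n} (\<lambda>S. c (vertex n S))"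
proof
  assume "scube w {..<n} (\<lambda>S. c (vertex n S))"
  from scube_imp_scalar_cube[OF this] show "scalar_cube w n c"
    using scalar_cube_cong[of n "\<lambda>v. c (vertex n (ones n v))" c] by (auto simp: vertex_ones)
qed (rule scalar_cube_imp_scube)

section \<open>Group products seen through coordinates and characters\<close>

lemma additive_finprod:
  fixes \<xi> :: "'a \<Rightarrow> 'b::comm_ring_1"
  assumes "comm_group G"
    and "\<And>x y. x \<in> carrier G \<Longrightarrow> y \<in> carrier G \<Longrightarrow> \<xi> (x \<otimes>\<^bsub>G\<^esub> y) = \<xi> x + \<xi> y"
    and "finite V" "\<And>v. v \<in> V \<Longrightarrow> g v \<in> carrier G"
  shows "\<xi> (\<Otimes>\<^bsub>G\<^esub>v\<in>V. g v [^]\<^bsub>G\<^esub> ((-1::int) ^ e v)) = (\<Sum>v\<in>V. (-1) ^ e v * \<xi> (g v))"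
proof -
  interpret comm_group G by fact
  have "\<xi> \<one>\<^bsub>G\<^esub> + \<xi> \<one>\<^bsub>G\<^esub> = \<xi> \<one>\<^bsub>G\<^esub>" using assms(2)[of "\<one>\<^bsub>G\<^esub>" "\<one>\<^bsub>G\<^esub>"] by simp
  then have one: "\<xi> \<one>\<^bsub>G\<^esub> = 0" by simp
  have inv: "\<xi> (inv\<^bsub>G\<^esub> x) = - \<xi> x" if "x \<in> carrier G" for x
    using assms(2)[of x "inv\<^bsub>G\<^esub> x"] that one by (simp add: eq_neg_iff_add_eq_0 add.commute)
  have pow: "\<xi> (x [^]\<^bsub>G\<^esub> ((-1::int) ^ i)) = (-1) ^ i * \<xi> x" if "x \<in> carrier G" for x i
    using that int_pow_neg[of x 1] inv by (cases "even i") auto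
  show ?thesis
    using assms(3,4)
  proof (induction V rule: finite_induct)
    case empty
    then show ?case using one by simp
  next
    case (insert v V)
    then show ?case
      by (subst finprod_insert) (auto simp: assms(2) pow Pi_iff)
  qed
qed

text \<open>The arguments \<open>\<theta> v\<close> are given for the factors only and need not come
  from a homomorphism, so they are carried along through the values of \<open>\<xi>\<close>.\<close>

lemma cis_character_finprod:
  assumes "comm_group G"
    and "\<And>x y. x \<in> carrier G \<Longrightarrow> y \<in> carrier G \<Longrightarrow> \<xi> (x \<otimes>\<^bsub>G\<^esub> y) = \<xi> x * \<xi> y"
    and "finite V" "\<And>v. v \<in> V \<Longrightarrow> g v \<in> carrier G"
    and "\<xi> \<one>\<^bsub>G\<^esub> = 1" "\<And>v. v \<in> V \<Longrightarrow> \<xi> (g v) = cis (\<theta> v)"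
  shows "\<xi> (\<Otimes>\<^bsub>G\<^esub>v\<in>V. g v [^]\<^bsub>G\<^esub> ((-1::int) ^ e v)) = cis (\<Sum>v\<in>V. (-1) ^ e v * \<theta> v)"
proof -
  interpret comm_group G by fact
  have inv: "\<xi> (inv\<^bsub>G\<^esub> x) = inverse (\<xi> x)" if "x \<in> carrier G" for x
    using assms(2)[of x "inv\<^bsub>G\<^esub> x"] that assms(5) by (simp add: inverse_unique)
  have pow: "\<xi> (x [^]\<^bsub>G\<^esub> ((-1::int) ^ i)) = cis ((-1) ^ i * t)" if "x \<in> carrier G" "\<xi> x = cis t" for x i t
    using that int_pow_neg[of x 1] inv by (cases "even i") auto
  show ?thesis
    using assms(3,4,6)
  proof (induction V rule: finite_induct)
    case empty
    then show ?case using assms(5) by simp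
  next
    case (insert v V)
    then show ?case
      by (subst finprod_insert) (auto simp: assms(2) pow Pi_iff cis_mult)
  qed
qed

lemma group_real_group: "group real_group"
  using comm_group_real_group by (simp add: comm_group_def)

lemma comm_group_product_group:
  assumes "\<And>i. i \<in> I \<Longrightarrow> comm_group (G i)"
  shows "comm_group (product_group I G)"
proof (rule group.group_comm_groupI)
  show "group (product_group I G)"
    using assms by (intro product_group) (simp add: comm_group_def)
qed (use assms in \<open>auto simp: PiE_iff comm_groupE(4) intro!: restrict_ext\<close>)

lemma comm_group_DirProd:
  assumes "comm_group G" "comm_group H"
  shows "comm_group (G \<times>\<times> H)"
proof (rule group.group_comm_groupI)
  show "group (G \<times>\<times> H)"
    using assms by (intro DirProd_group) (simp_all add: comm_group_def)
qed (use assms in \<open>auto simp: comm_groupE(4)\<close>)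

lemma comm_group_ZR_group: "comm_group (ZR_group a b)"
  unfolding ZR_group_def
  by (intro comm_group_DirProd comm_group_product_group abelian_integer_group comm_group_real_group)

lemma carrier_ZR_group: "carrier (ZR_group a b) = ({..<a} \<rightarrow>\<^sub>E UNIV) \<times> ({..<b} \<rightarrow>\<^sub>E UNIV)"
  by (simp add: ZR_group_def real_group_def)

lemma mult_ZR_group:
  "x \<otimes>\<^bsub>ZR_group a b\<^esub> y = (\<lambda>p\<in>{..<a}. fst x p + fst y p, \<lambda>q\<in>{..<b}. snd x q + snd y q)"
  by (cases x; cases y) (simp add: ZR_group_def real_group_def)

lemma ZR_group_eq_one_iff:
  assumes "x \<in> carrier (ZR_group a b)"
  shows "x = \<one>\<^bsub>ZR_group a b\<^esub> \<longleftrightarrow> (\<forall>p<a. fst x p = 0) \<and> (\<forall>q<b. snd x q = 0)"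
  using assms by (cases x) (auto simp: ZR_group_def real_group_def PiE_iff extensional_def fun_eq_iff)

text \<open>The coordinate functions are additive and together detect the identity, so the cube
  condition splits into one scalar condition per coordinate.\<close>

lemma cubes_D_nilspace_ZR_group:
  "c \<in> cubes (D_nilspace i (ZR_group a b)) n \<longleftrightarrow> c \<in> vertices n \<rightarrow>\<^sub>E carrier (ZR_group a b) \<and>
    (\<forall>p<a. scalar_cube i n (\<lambda>v. fst (c v) p)) \<and> (\<forall>q<b. scalar_cube i n (\<lambda>v. snd (c v) q))"
proof -
  interpret comm_group "ZR_group a b" by (rule comm_group_ZR_group)
  have "(\<Otimes>\<^bsub>ZR_group a b\<^esub>v\<in>vertices (i + 1). c (\<rho> v) [^]\<^bsub>ZR_group a b\<^esub> ((-1::int) ^ (\<Sum>j<i + 1. v j))) = \<one>\<^bsub>ZR_group a b\<^esub>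
    \<longleftrightarrow> (\<forall>p<a. (\<Sum>v\<in>vertices (i + 1). (-1) ^ (\<Sum>j<i + 1. v j) * fst (c (\<rho> v)) p) = 0) \<and>
        (\<forall>q<b. (\<Sum>v\<in>vertices (i + 1). (-1) ^ (\<Sum>j<i + 1. v j) * snd (c (\<rho> v)) q) = 0)"
    (is "?x = _ \<longleftrightarrow> _")
    if c: "c \<in> vertices n \<rightarrow>\<^sub>E carrier (ZR_group a b)" and \<rho>: "\<rho> \<in> discrete_cube_morphisms (i + 1) n" for \<rho>
  proof -
    have closed: "c (\<rho> v) \<in> carrier (ZR_group a b)" if "v \<in> vertices (i + 1)" for v
      using c discrete_cube_morphism_vertices[OF \<rho> that] by auto
    have "fst ?x p = (\<Sum>v\<in>vertices (i + 1). (-1) ^ (\<Sum>j<i + 1. v j) * fst (c (\<rho> v)) p)" if "p < a" for p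
      by (rule additive_finprod[where \<xi> = "\<lambda>x. fst x p"])
        (use that closed in \<open>auto simp: mult_ZR_group comm_group_ZR_group finite_vertices\<close>)
    moreover have "snd ?x q = (\<Sum>v\<in>vertices (i + 1). (-1) ^ (\<Sum>j<i + 1. v j) * snd (c (\<rho> v)) q)" if "q < b" for q
      by (rule additive_finprod[where \<xi> = "\<lambda>x. snd x q"])
        (use that closed in \<open>auto simp: mult_ZR_group comm_group_ZR_group finite_vertices\<close>)
    moreover have "?x \<in> carrier (ZR_group a b)"
      using closed by (intro finprod_closed) auto
    ultimately show ?thesis by (simp add: ZR_group_eq_one_iff)
  qed
  then show ?thesis
    unfolding D_nilspace_def scalar_cube_def by (auto simp del: sum.lessThan_Suc)
qed

section \<open>Cubes in free nilspaces\<close>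

text \<open>The values are points at every \<open>W\<close>, not just at subsets of
  \<open>N\<close>, so passing to a face leaves no side condition on them.\<close>

definition free_cube :: "nat \<Rightarrow> (nat \<Rightarrow> nat) \<Rightarrow> (nat \<Rightarrow> nat) \<Rightarrow> nat set \<Rightarrow>
    (nat set \<Rightarrow> nat \<Rightarrow> (nat \<Rightarrow> int) \<times> (nat \<Rightarrow> real)) \<Rightarrow> bool" where
  "free_cube m a b N c \<longleftrightarrow> (\<forall>W. c W \<in> points (free_nilspace m a b)) \<and>
     (\<forall>i\<in>{1..m}. (\<forall>p<a i. scube i N (\<lambda>W. fst (c W i) p)) \<and> (\<forall>q<b i. scube i N (\<lambda>W. snd (c W i) q)))"

lemma points_free_nilspace:
  "points (free_nilspace m a b) = (\<Pi>\<^sub>E i\<in>{1..m}. ({..<a i} \<rightarrow>\<^sub>E UNIV) \<times> ({..<b i} \<rightarrow>\<^sub>E UNIV))"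
  by (simp add: free_nilspace_def product_cubespace_def D_nilspace_def carrier_ZR_group)

lemma cubes_free_nilspace:
  "c \<in> cubes (free_nilspace m a b) n \<longleftrightarrow> c \<in> vertices n \<rightarrow>\<^sub>E points (free_nilspace m a b) \<and>
    (\<forall>i\<in>{1..m}. (\<forall>p<a i. scalar_cube i n (\<lambda>v. fst (c v i) p)) \<and> (\<forall>q<b i. scalar_cube i n (\<lambda>v. snd (c v i) q)))"
proof -
  have "(\<lambda>v\<in>vertices n. c v i) \<in> cubes (D_nilspace i (ZR_group (a i) (b i))) n \<longleftrightarrow>
      (\<forall>p<a i. scalar_cube i n (\<lambda>v. fst (c v i) p)) \<and> (\<forall>q<b i. scalar_cube i n (\<lambda>v. snd (c v i) q))"
    if c: "c \<in> vertices n \<rightarrow>\<^sub>E points (free_nilspace m a b)" and i: "i \<in> {1..m}" for i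
  proof -
    have "(\<lambda>v\<in>vertices n. c v i) \<in> vertices n \<rightarrow>\<^sub>E carrier (ZR_group (a i) (b i))"
      using c i unfolding points_free_nilspace carrier_ZR_group by (auto simp: PiE_iff)
    moreover have "scalar_cube i n (\<lambda>v. fst ((\<lambda>v\<in>vertices n. c v i) v) p) = scalar_cube i n (\<lambda>v. fst (c v i) p)" for p
      by (rule scalar_cube_cong) simp
    moreover have "scalar_cube i n (\<lambda>v. snd ((\<lambda>v\<in>vertices n. c v i) v) q) = scalar_cube i n (\<lambda>v. snd (c v i) q)" for q
      by (rule scalar_cube_cong) simp
    ultimately show ?thesis
      unfolding cubes_D_nilspace_ZR_group by blast
  qed
  moreover have "c \<in> cubes (free_nilspace m a b) n \<longleftrightarrow> c \<in> vertices n \<rightarrow>\<^sub>E points (free_nilspace m a b) \<and>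
      (\<forall>i\<in>{1..m}. (\<lambda>v\<in>vertices n. c v i) \<in> cubes (D_nilspace i (ZR_group (a i) (b i))) n)"
    by (simp add: free_nilspace_def product_cubespace_def)
  ultimately show ?thesis by blast
qed

lemma free_cube_of_cube:
  "c \<in> cubes (free_nilspace m a b) n \<Longrightarrow> free_cube m a b {..<n} (\<lambda>S. c (vertex n S))"
  by (auto simp: cubes_free_nilspace free_cube_def scalar_cube_iff_scube)

lemma cube_of_free_cube:
  assumes "free_cube m a b {..<n} c"
  shows "(\<lambda>v\<in>vertices n. c (ones n v)) \<in> cubes (free_nilspace m a b) n"
proof -
  have "scalar_cube i n (\<lambda>v. fst ((\<lambda>v\<in>vertices n. c (ones n v)) v i) p)" if "i \<in> {1..m}" "p < a i" for i p
    using scube_imp_scalar_cube[of i n "\<lambda>W. fst (c W i) p"] that assms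
    by (subst scalar_cube_cong[where c' = "\<lambda>v. fst (c (ones n v) i) p"]) (auto simp: free_cube_def)
  moreover have "scalar_cube i n (\<lambda>v. snd ((\<lambda>v\<in>vertices n. c (ones n v)) v i) q)" if "i \<in> {1..m}" "q < b i" for i q
    using scube_imp_scalar_cube[of i n "\<lambda>W. snd (c W i) q"] that assms
    by (subst scalar_cube_cong[where c' = "\<lambda>v. snd (c (ones n v) i) q"]) (auto simp: free_cube_def)
  ultimately show ?thesis
    using assms unfolding cubes_free_nilspace by (auto simp: free_cube_def)
qed

lemma free_cube_pullback:
  assumes "free_cube m a b N c"
  shows "free_cube m a b M (\<lambda>W. c (W \<inter> N))"
  using assms scube_pullback[of _ N "\<lambda>W. fst (c W _) _" M] scube_pullback[of _ N "\<lambda>W. snd (c W _) _" M]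
  by (auto simp: free_cube_def)

lemma free_cube_face:
  assumes "free_cube m a b N c" "T \<subseteq> N" "U \<subseteq> N" "T \<inter> U = {}"
  shows "free_cube m a b U (\<lambda>W. c (T \<union> W))"
  using assms scube_face[of _ N "\<lambda>W. fst (c W _) _" T U] scube_face[of _ N "\<lambda>W. snd (c W _) _" T U]
  by (auto simp: free_cube_def Un_commute)

section \<open>From nilspace morphisms to alternating sums and back\<close>

lemma cis_2pi_eq_1_iff: "cis (2 * pi * x) = 1 \<longleftrightarrow> x \<in> \<int>"
proof
  assume "cis (2 * pi * x) = 1"
  then have "cos (2 * pi * x) = 1" by (simp add: complex_eq_iff)
  then obtain k :: int where "2 * pi * x = of_int k * 2 * pi" by (auto simp: cos_one_2pi_int)
  then have "x = of_int k" by simp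
  then show "x \<in> \<int>" by simp
qed (rule cis_multiple_2pi)

text \<open>On a face with \<open>k + 1\<close> directions the product over the image cube is the
  identity, so its character value 1 is the exponential of the sum of \<open>\<theta>\<close>.
  Larger cubes follow by \<open>alt_mem_of_card_ge\<close>.\<close>

lemma alt_character_Ints:
  assumes G: "comm_group G"
    and \<phi>: "nilspace_morphism (free_nilspace m a b) (D_nilspace k G) \<phi>"
    and \<xi>: "\<And>x y. x \<in> carrier G \<Longrightarrow> y \<in> carrier G \<Longrightarrow> \<xi> (x \<otimes>\<^bsub>G\<^esub> y) = \<xi> x * \<xi> y" "\<xi> \<one>\<^bsub>G\<^esub> = 1"
    and \<theta>: "\<And>z. z \<in> points (free_nilspace m a b) \<Longrightarrow> \<xi> (\<phi> z) = cis (2 * pi * \<theta> z)"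
    and N: "finite N" "k + 1 \<le> card N" and c: "free_cube m a b N c"
  shows "alt N (\<lambda>W. \<theta> (c W)) \<in> \<int>"
proof (rule alt_mem_of_card_ge[OF N])
  fix T U assume TU: "T \<subseteq> N" "U \<subseteq> N" "T \<inter> U = {}" "card U = k + 1"
  \<comment> \<open>\<open>N\<close> need not be an initial segment, whereas \<open>\<phi>\<close>
    is a morphism on \<open>n\<close>-cubes; so \<open>c\<close> is first pulled back to
    \<open>{..<n}\<close>.\<close>
  obtain n where n: "N \<subseteq> {..<n}" using \<open>finite N\<close> finite_nat_iff_bounded by auto
  define c' where "c' = (\<lambda>v\<in>vertices n. c (ones n v \<inter> N))"
  have c': "c' \<in> cubes (free_nilspace m a b) n"
    unfolding c'_def by (rule cube_of_free_cube) (rule free_cube_pullback[OF c])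
  have pts: "c' v \<in> points (free_nilspace m a b)" if "v \<in> vertices n" for v
    using that c by (simp add: c'_def free_cube_def)
  have carr: "\<phi> z \<in> carrier G" if "z \<in> points (free_nilspace m a b)" for z
    using \<phi> that by (auto simp: nilspace_morphism_def D_nilspace_def)
  have TUn: "T \<subseteq> {..<n}" "U \<subseteq> {..<n}" using TU n by auto
  obtain \<rho> g where \<rho>: "\<rho> \<in> discrete_cube_morphisms (k + 1) n"
    "bij_betw g {..<k + 1} U" "\<forall>S\<subseteq>{..<k + 1}. \<rho> (vertex (k + 1) S) = vertex n (T \<union> g ` S)"
    using exists_face_morphism[OF TUn TU(3,4)] by auto
  have \<rho>v: "\<rho> v \<in> vertices n" if "v \<in> vertices (k + 1)" for v
    using \<rho>(1) that by (rule discrete_cube_morphism_vertices)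
  interpret comm_group G by (rule G)
  have "(\<lambda>v\<in>vertices n. \<phi> (c' v)) \<in> cubes (D_nilspace k G) n"
    using \<phi> c' by (auto simp: nilspace_morphism_def)
  then have "(\<Otimes>\<^bsub>G\<^esub>v\<in>vertices (k + 1). (\<lambda>v\<in>vertices n. \<phi> (c' v)) (\<rho> v) [^]\<^bsub>G\<^esub> ((-1::int) ^ (\<Sum>j<k + 1. v j))) = \<one>\<^bsub>G\<^esub>"
    using \<rho>(1) by (simp add: D_nilspace_def)
  moreover have "\<xi> (\<Otimes>\<^bsub>G\<^esub>v\<in>vertices (k + 1). (\<lambda>v\<in>vertices n. \<phi> (c' v)) (\<rho> v) [^]\<^bsub>G\<^esub> ((-1::int) ^ (\<Sum>j<k + 1. v j))) =
      cis (\<Sum>v\<in>vertices (k + 1). (-1) ^ (\<Sum>j<k + 1. v j) * (2 * pi * \<theta> (c' (\<rho> v))))"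
    by (rule cis_character_finprod) (use G \<xi> \<theta> carr pts \<rho>v in \<open>auto simp: finite_vertices\<close>)
  ultimately have "cis (\<Sum>v\<in>vertices (k + 1). (-1) ^ (\<Sum>j<k + 1. v j) * (2 * pi * \<theta> (c' (\<rho> v)))) = 1"
    using \<xi>(2) by simp
  also have "(\<Sum>v\<in>vertices (k + 1). (-1) ^ (\<Sum>j<k + 1. v j) * (2 * pi * \<theta> (c' (\<rho> v)))) =
      2 * pi * alt {..<k + 1} (\<lambda>S. \<theta> (c' (\<rho> (vertex (k + 1) S))))"
    unfolding sum_vertices_eq_alt alt_mult_left ..
  finally have "alt {..<k + 1} (\<lambda>S. \<theta> (c' (\<rho> (vertex (k + 1) S)))) \<in> \<int>"
    by (simp only: cis_2pi_eq_1_iff)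
  also have "alt {..<k + 1} (\<lambda>S. \<theta> (c' (\<rho> (vertex (k + 1) S)))) = alt U (\<lambda>W. \<theta> (c' (vertex n (T \<union> W))))"
    by (rule alt_face[OF \<rho>(2,3), where f = "\<lambda>v. \<theta> (c' v)"])
  also have "\<dots> = alt U (\<lambda>W. \<theta> (c (T \<union> W)))"
  proof (rule alt_cong)
    fix W assume "W \<subseteq> U"
    then have "(T \<union> W) \<inter> {..<n} \<inter> N = T \<union> W" using TU n by blast
    then show "\<theta> (c' (vertex n (T \<union> W))) = \<theta> (c (T \<union> W))" by (simp add: c'_def)
  qed
  finally show "alt U (\<lambda>W. \<theta> (c (T \<union> W))) \<in> \<int>" .
qed auto

text \<open>A face of a cube is a free cube on its own directions, and by
  \<open>scalar_cube_iff_scube\<close> the target condition concerns exactly the faces with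
  \<open>k + 1\<close> directions.\<close>

lemma nilspace_morphism_free_ZR_group:
  assumes "\<psi> \<in> points (free_nilspace m a b) \<rightarrow> carrier (ZR_group r s)"
    and "\<And>N c j. finite N \<Longrightarrow> k + 1 \<le> card N \<Longrightarrow> free_cube m a b N c \<Longrightarrow> j < r \<Longrightarrow> alt N (\<lambda>W. fst (\<psi> (c W)) j) = 0"
    and "\<And>N c j. finite N \<Longrightarrow> k + 1 \<le> card N \<Longrightarrow> free_cube m a b N c \<Longrightarrow> j < s \<Longrightarrow> alt N (\<lambda>W. snd (\<psi> (c W)) j) = 0"
  shows "nilspace_morphism (free_nilspace m a b) (D_nilspace k (ZR_group r s)) \<psi>"
  unfolding nilspace_morphism_def
proof (intro conjI allI ballI)
  show "\<psi> \<in> points (free_nilspace m a b) \<rightarrow> points (D_nilspace k (ZR_group r s))"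
    using assms(1) by (simp add: D_nilspace_def)
  fix n c assume c: "c \<in> cubes (free_nilspace m a b) n"
  have face: "free_cube m a b U (\<lambda>W. c (vertex n (T \<union> W)))" "finite U"
    if "T \<subseteq> {..<n}" "U \<subseteq> {..<n}" "T \<inter> U = {}" for T U
    using free_cube_face[OF free_cube_of_cube[OF c] that] finite_subset[OF that(2)] by auto
  have "c \<in> vertices n \<rightarrow>\<^sub>E points (free_nilspace m a b)"
    using c by (simp add: cubes_free_nilspace)
  then have "(\<lambda>v\<in>vertices n. \<psi> (c v)) \<in> vertices n \<rightarrow>\<^sub>E carrier (ZR_group r s)"
    using assms(1) by auto
  then show "(\<lambda>v\<in>vertices n. \<psi> (c v)) \<in> cubes (D_nilspace k (ZR_group r s)) n"
    unfolding cubes_D_nilspace_ZR_group scalar_cube_iff_scube scube_def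
    using assms(2,3)[OF face(2) _ face(1)] by auto
qed

section \<open>Lifting modulo 1\<close>

text \<open>All integer coordinates form one family indexed by pairs; the default 0 is the one that
  \<open>icube\<close> demands.\<close>

definition int_coords :: "nat \<Rightarrow> (nat \<Rightarrow> nat) \<Rightarrow> (nat \<Rightarrow> (nat \<Rightarrow> int) \<times> 'r) \<Rightarrow> nat \<times> nat \<Rightarrow> int" where
  "int_coords m a z = (\<lambda>(i, p). if i \<in> {1..m} \<and> p < a i then fst (z i) p else 0)"

text \<open>The argument \<open>x\<close> selects a connected component and \<open>y\<close> a
  position in it, so the real coordinates can move while the component stays fixed.\<close>

definition free_point :: "nat \<Rightarrow> (nat \<Rightarrow> nat) \<Rightarrow> (nat \<Rightarrow> nat) \<Rightarrow> (nat \<times> nat \<Rightarrow> int) \<Rightarrow> (nat \<times> nat \<Rightarrow> real) \<Rightarrow>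
    nat \<Rightarrow> (nat \<Rightarrow> int) \<times> (nat \<Rightarrow> real)" where
  "free_point m a b x y = (\<lambda>i\<in>{1..m}. (\<lambda>p\<in>{..<a i}. x (i, p), \<lambda>q\<in>{..<b i}. y (i, q)))"

lemma free_point_in_points [simp]: "free_point m a b x y \<in> points (free_nilspace m a b)"
  by (auto simp: points_free_nilspace free_point_def)

lemma free_point_coords:
  assumes "z \<in> points (free_nilspace m a b)"
    and "\<And>i q. i \<in> {1..m} \<Longrightarrow> q < b i \<Longrightarrow> y (i, q) = snd (z i) q"
  shows "free_point m a b (int_coords m a z) y = z"
proof
  fix i
  show "free_point m a b (int_coords m a z) y i = z i"
  proof (cases "i \<in> {1..m}")
    case True
    then have "fst (z i) \<in> {..<a i} \<rightarrow>\<^sub>E UNIV" "snd (z i) \<in> {..<b i} \<rightarrow>\<^sub>E UNIV"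
      using assms(1) by (auto simp: points_free_nilspace PiE_iff mem_Times_iff)
    then show ?thesis
      using True assms(2) by (auto simp: free_point_def int_coords_def PiE_iff extensional_def prod_eq_iff fun_eq_iff)
  next
    case False
    then show ?thesis
      using assms(1) by (auto simp: points_free_nilspace free_point_def PiE_iff extensional_def)
  qed
qed

section \<open>Continuity on free nilspaces\<close>

lemma continuous_map_free_int:
  assumes "i \<in> {1..m}" "p < a i"
  shows "continuous_map (free_topology m a b) (discrete_topology UNIV) (\<lambda>z. fst (z i) p)"
proof -
  have "continuous_map (free_topology m a b) (ZR_topology (a i) (b i)) (\<lambda>z. z i)"
    unfolding free_topology_def using assms(1) by (rule continuous_map_product_projection)
  then have "continuous_map (free_topology m a b) (product_topology (\<lambda>_. discrete_topology UNIV) {..<a i}) (\<lambda>z. fst (z i))"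
    unfolding ZR_topology_def by (rule continuous_map_fst_of[unfolded o_def])
  then show ?thesis
    by (rule continuous_map_product_then_coordinatewise) (use assms in simp)
qed

lemma continuous_map_free_real:
  assumes "i \<in> {1..m}" "q < b i"
  shows "continuous_map (free_topology m a b) euclideanreal (\<lambda>z. snd (z i) q)"
proof -
  have "continuous_map (free_topology m a b) (ZR_topology (a i) (b i)) (\<lambda>z. z i)"
    unfolding free_topology_def using assms(1) by (rule continuous_map_product_projection)
  then have "continuous_map (free_topology m a b) (product_topology (\<lambda>_. euclideanreal) {..<b i}) (\<lambda>z. snd (z i))"
    unfolding ZR_topology_def by (rule continuous_map_snd_of[unfolded o_def])
  then show ?thesis
    by (rule continuous_map_product_then_coordinatewise) (use assms in simp)
qed

lemma continuous_map_free_point: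
  assumes "\<And>k. continuous_map X euclideanreal (\<lambda>u. y u k)"
  shows "continuous_map X (free_topology m a b) (\<lambda>u. free_point m a b x (y u))"
  unfolding free_topology_def continuous_map_componentwise ZR_topology_def
proof (intro conjI ballI)
  fix i assume "i \<in> {1..m}"
  moreover have "continuous_map X (product_topology (\<lambda>_. discrete_topology UNIV) {..<a i}) (\<lambda>u. \<lambda>p\<in>{..<a i}. x (i, p))"
    by simp
  moreover have "continuous_map X (product_topology (\<lambda>_. euclideanreal) {..<b i}) (\<lambda>u. \<lambda>q\<in>{..<b i}. y u (i, q))"
    using assms by (auto simp: continuous_map_componentwise)
  ultimately show "continuous_map X (prod_topology (product_topology (\<lambda>_. discrete_topology UNIV) {..<a i})
      (product_topology (\<lambda>_. euclideanreal) {..<b i})) (\<lambda>u. free_point m a b x (y u) i)"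
    by (simp add: free_point_def continuous_map_paired)
qed (auto simp: free_point_def)

lemma openin_Collect_finite_all:
  assumes "finite K" "\<And>k. k \<in> K \<Longrightarrow> openin X {z \<in> topspace X. P k z}"
  shows "openin X {z \<in> topspace X. \<forall>k\<in>K. P k z}"
  using assms
proof (induction K rule: finite_induct)
  case (insert k K)
  have "{z \<in> topspace X. \<forall>k\<in>insert k K. P k z} = {z \<in> topspace X. P k z} \<inter> {z \<in> topspace X. \<forall>k\<in>K. P k z}"
    by auto
  with insert show ?case by auto
qed auto

text \<open>The integer coordinates are finitely many and discrete, so they are locally constant,
  and functions chosen separately for each value \<open>x\<close> paste together.\<close>

lemma continuous_map_by_int_coords:
  assumes "\<And>x. continuous_map (free_topology m a b) Y (H x)"
  shows "continuous_map (free_topology m a b) Y (\<lambda>z. H (int_coords m a z) z)"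
proof (rule pasting_lemma[where I = UNIV and f = H and
      T = "\<lambda>x. {z \<in> topspace (free_topology m a b). int_coords m a z = x}"])
  fix x
  let ?X = "free_topology m a b"
  define K where "K = Sigma {1..m} (\<lambda>i. {..<a i})"
  show "openin ?X {z \<in> topspace ?X. int_coords m a z = x}"
  proof (cases "\<forall>k. k \<notin> K \<longrightarrow> x k = 0")
    case True
    have "{z \<in> topspace ?X. int_coords m a z = x} = {z \<in> topspace ?X. \<forall>k\<in>K. fst (z (fst k)) (snd k) = x k}"
      using True by (auto simp: int_coords_def K_def fun_eq_iff)
    moreover have "openin ?X {z \<in> topspace ?X. \<forall>k\<in>K. fst (z (fst k)) (snd k) = x k}"
    proof (rule openin_Collect_finite_all)
      fix k assume "k \<in> K"
      then have "continuous_map ?X (discrete_topology UNIV) (\<lambda>z. fst (z (fst k)) (snd k))"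
        by (intro continuous_map_free_int) (auto simp: K_def)
      from openin_continuous_map_preimage[OF this, of "{x k}"]
      show "openin ?X {z \<in> topspace ?X. fst (z (fst k)) (snd k) = x k}" by simp
    qed (simp add: K_def)
    ultimately show ?thesis by simp
  next
    case False
    then have "{z \<in> topspace ?X. int_coords m a z = x} = {}"
      by (auto simp: int_coords_def K_def)
    then show ?thesis by (simp only: openin_empty)
  qed
qed (use assms in \<open>auto intro: continuous_map_from_subtopology\<close>)

lemma apply_bcontfun_sum: "apply_bcontfun (sum f A) x = (\<Sum>k\<in>A. apply_bcontfun (f k) x)"
  by (induction A rule: infinite_finite_induct) auto

lemma continuous_on_bcontfun_eval:
  "continuous_on UNIV (\<lambda>u :: 'a::topological_space \<Rightarrow>\<^sub>C 'b::real_normed_vector. apply_bcontfun u x)"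
proof (rule continuous_on_compose2[of UNIV "\<lambda>u. u"])
  have "bounded_linear (\<lambda>u :: 'a \<Rightarrow>\<^sub>C 'b. apply_bcontfun u x)"
    by (rule bounded_linear_intro[where K = 1]) (auto simp: norm_bounded)
  then show "continuous_on UNIV (\<lambda>u :: 'a \<Rightarrow>\<^sub>C 'b. apply_bcontfun u x)"
    by (rule linear_continuous_on)
qed auto

definition bump :: "nat \<Rightarrow> nat \<Rightarrow>\<^sub>C real" where
  "bump n = Bcontfun (\<lambda>j. if j = n then 1 else 0)"

lemma apply_bump: "apply_bcontfun (bump n) j = (if j = n then 1 else 0)"
  unfolding bump_def
  by (subst Bcontfun_inverse) (auto intro!: bcontfun_normI[where b = 1] simp: continuous_on_open_vimage open_discrete)

text \<open>Each component of the free nilspace is a finite-dimensional real vector space. As its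
  dimension is not a type, the component is realised as a retract of the normed space of bounded
  sequences, on which continuous logarithms exist.\<close>

lemma continuous_lift_mod_1:
  assumes cont: "continuous_map (free_topology m a b) euclidean (\<lambda>z. cis (2 * pi * \<theta> z))"
  shows "\<exists>\<psi>. continuous_map (free_topology m a b) euclideanreal \<psi> \<and>
    (\<forall>z\<in>points (free_nilspace m a b). \<psi> z - \<theta> z \<in> \<int>)"
proof -
  let ?X = "free_topology m a b"
  define K where "K = Sigma {1..m} (\<lambda>i. {..<b i})"
  \<comment> \<open>\<open>emb\<close> stores the real coordinates in a bounded sequence, with
    positions numbered by \<open>prod_encode\<close>, and \<open>dec\<close> reads them
    back.\<close>
  define dec where "dec = (\<lambda>u k. apply_bcontfun (u :: nat \<Rightarrow>\<^sub>C real) (prod_encode k))"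
  define emb where "emb = (\<lambda>z :: nat \<Rightarrow> (nat \<Rightarrow> int) \<times> (nat \<Rightarrow> real). \<Sum>k\<in>K. snd (z (fst k)) (snd k) *\<^sub>R bump (prod_encode k))"
  have finK: "finite K" by (simp add: K_def)
  have emb: "continuous_map ?X euclidean emb"
    unfolding emb_def
  proof (rule continuous_map_sum[OF finK])
    fix k assume "k \<in> K"
    then have "continuous_map ?X euclideanreal (\<lambda>z. snd (z (fst k)) (snd k))"
      by (intro continuous_map_free_real) (auto simp: K_def)
    moreover have "continuous_map euclideanreal euclidean (\<lambda>t. t *\<^sub>R bump (prod_encode k))"
      by (auto intro!: continuous_intros)
    ultimately show "continuous_map ?X euclidean (\<lambda>z. snd (z (fst k)) (snd k) *\<^sub>R bump (prod_encode k))"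
      using continuous_map_compose[of ?X euclideanreal _ euclidean] by (fastforce simp: o_def)
  qed
  have dec_emb: "free_point m a b (int_coords m a z) (dec (emb z)) = z" if "z \<in> points (free_nilspace m a b)" for z
  proof (rule free_point_coords[OF that])
    fix i q assume "i \<in> {1..m}" "q < b i"
    then have "(i, q) \<in> K" by (simp add: K_def)
    have "dec (emb z) (i, q) = (\<Sum>k\<in>K. if k = (i, q) then snd (z (fst k)) (snd k) else 0)"
      by (auto simp: dec_def emb_def apply_bcontfun_sum apply_bump prod_encode_eq intro!: sum.cong)
    also have "\<dots> = snd (z i) q" using finK \<open>(i, q) \<in> K\<close> by simp
    finally show "dec (emb z) (i, q) = snd (z i) q" .
  qed
  \<comment> \<open>For fixed integer coordinates the exponential becomes a continuous function
    without zeros on a contractible space, so it has a continuous logarithm.\<close>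
  have "\<forall>x. \<exists>g. continuous_on UNIV g \<and> (\<forall>u. cis (2 * pi * \<theta> (free_point m a b x (dec u))) = exp (g u))"
  proof
    fix x
    have "continuous_map euclidean ?X (\<lambda>u. free_point m a b x (dec u))"
      by (rule continuous_map_free_point) (simp add: dec_def continuous_on_bcontfun_eval)
    from continuous_map_compose[OF this cont]
    have "continuous_on UNIV (\<lambda>u. cis (2 * pi * \<theta> (free_point m a b x (dec u))))"
      by (simp add: o_def)
    moreover have "contractible (UNIV :: (nat \<Rightarrow>\<^sub>C real) set)"
      by (rule convex_imp_contractible) simp
    ultimately obtain g where "continuous_on UNIV g"
      "\<And>u. u \<in> UNIV \<Longrightarrow> cis (2 * pi * \<theta> (free_point m a b x (dec u))) = exp (g u)"
      by (rule continuous_logarithm_on_contractible) auto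
    then show "\<exists>g. continuous_on UNIV g \<and> (\<forall>u. cis (2 * pi * \<theta> (free_point m a b x (dec u))) = exp (g u))"
      by auto
  qed
  from choice[OF this] obtain g where g: "\<And>x. continuous_on UNIV (g x)"
    "\<And>x u. cis (2 * pi * \<theta> (free_point m a b x (dec u))) = exp (g x u)" by blast
  \<comment> \<open>The exponential has modulus 1, so the logarithm is purely imaginary; dividing
    its imaginary part by the period gives \<open>\<theta>\<close> up to integers.\<close>
  define \<psi> where "\<psi> = (\<lambda>z. Im (g (int_coords m a z) (emb z)) / (2 * pi))"
  have "continuous_map ?X euclideanreal \<psi>"
    unfolding \<psi>_def
  proof (rule continuous_map_by_int_coords[where H = "\<lambda>x z. Im (g x (emb z)) / (2 * pi)"])
    fix x
    have "continuous_map euclidean euclideanreal (\<lambda>u. Im (g x u) / (2 * pi))"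
      by (auto intro!: continuous_intros g)
    from continuous_map_compose[OF emb this]
    show "continuous_map ?X euclideanreal (\<lambda>z. Im (g x (emb z)) / (2 * pi))"
      by (simp add: o_def)
  qed
  moreover have "\<psi> z - \<theta> z \<in> \<int>" if "z \<in> points (free_nilspace m a b)" for z
  proof -
    have eq: "cis (2 * pi * \<theta> z) = exp (g (int_coords m a z) (emb z))"
      using g(2)[of "int_coords m a z" "emb z"] dec_emb[OF that] by simp
    then have "norm (exp (g (int_coords m a z) (emb z))) = 1"
      by (metis norm_cis)
    then have "Re (g (int_coords m a z) (emb z)) = 0"
      by (simp only: norm_exp_eq_Re exp_eq_one_iff)
    then have "exp (g (int_coords m a z) (emb z)) = cis (2 * pi * \<psi> z)"
      by (simp add: \<psi>_def exp_eq_polar)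
    with eq have "cis (2 * pi * (\<psi> z - \<theta> z)) = 1"
      by (simp add: right_diff_distrib flip: cis_divide)
    then show ?thesis by (simp only: cis_2pi_eq_1_iff)
  qed
  ultimately show ?thesis by blast
qed

section \<open>Correcting the continuous lift\<close>

lemma alt_contract_real_coords:
  assumes cont: "continuous_map (free_topology m a b) euclideanreal \<psi>"
    and int: "\<And>c. free_cube m a b N c \<Longrightarrow> alt N (\<lambda>W. \<psi> (c W)) \<in> \<int>"
    and c: "free_cube m a b N c"
  shows "alt N (\<lambda>W. \<psi> (c W)) = alt N (\<lambda>W. \<psi> (free_point m a b (int_coords m a (c W)) (\<lambda>_. 0)))"
proof -
  \<comment> \<open>Since \<open>scube\<close> is stable under scalar multiples, each
    \<open>cs t\<close> is a cube; it has the integer coordinates of \<open>c\<close>, and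
    \<open>cs 1\<close> is \<open>c\<close>.\<close>
  define cs where "cs = (\<lambda>t W. free_point m a b (int_coords m a (c W)) (\<lambda>(i, q). t * snd (c W i) q))"
  have pts: "c W \<in> points (free_nilspace m a b)" for W
    using c by (simp add: free_cube_def)
  have cs: "free_cube m a b N (cs t)" for t
    using c scube_mult_left[of _ N "\<lambda>W. snd (c W _) _" t]
    by (auto simp: free_cube_def cs_def) (auto simp: free_point_def int_coords_def)
  have cs0: "cs 0 W = free_point m a b (int_coords m a (c W)) (\<lambda>_. 0)" for W
    by (simp add: cs_def case_prod_unfold)
  have cs1: "cs 1 W = c W" for W
    unfolding cs_def by (rule free_point_coords[OF pts]) simp
  define G where "G = (\<lambda>t. alt N (\<lambda>W. \<psi> (cs t W)))"
  have G_Ints: "G t \<in> \<int>" for t unfolding G_def by (rule int[OF cs])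
  have "continuous_on UNIV (\<lambda>t. \<psi> (cs t W))" for W
  proof -
    have "continuous_map euclideanreal (free_topology m a b) (\<lambda>t. cs t W)"
      unfolding cs_def by (rule continuous_map_free_point) (auto intro!: continuous_intros simp: case_prod_unfold)
    from continuous_map_compose[OF this cont] show ?thesis by (simp add: o_def)
  qed
  then have "continuous_on UNIV G"
    unfolding G_def alt_def by (intro continuous_intros)
  \<comment> \<open>Distinct integers differ by at least 1, so a continuous integer-valued function
    on the line cannot jump.\<close>
  have "G constant_on UNIV"
  proof (rule continuous_discrete_range_constant[OF connected_UNIV \<open>continuous_on UNIV G\<close>])
    fix x :: real
    have "1 \<le> norm (G y - G x)" if "G y \<noteq> G x" for y
      using that Ints_diff[OF G_Ints G_Ints, of y x] by (auto intro: Ints_nonzero_abs_ge1)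
    then show "\<exists>e>0. \<forall>y. y \<in> UNIV \<and> G y \<noteq> G x \<longrightarrow> e \<le> norm (G y - G x)"
      by (intro exI[of _ 1]) auto
  qed
  then have "G 1 = G 0" unfolding constant_on_def by (metis UNIV_I)
  then show ?thesis by (simp add: G_def cs0 cs1)
qed

text \<open>A continuous lift \<open>\<psi>0\<close> has the same sums as its restriction
  \<open>f\<close> to real coordinates 0. Replacing \<open>f\<close> by its correction
  \<open>f'\<close> therefore makes the sums of the lift vanish.\<close>

lemma polynomial_lift_mod_1:
  assumes cont: "continuous_map (free_topology m a b) euclidean (\<lambda>z. cis (2 * pi * \<theta> z))"
    and poly: "\<And>N c. finite N \<Longrightarrow> d \<le> card N \<Longrightarrow> free_cube m a b N c \<Longrightarrow> alt N (\<lambda>W. \<theta> (c W)) \<in> \<int>"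
  shows "\<exists>\<psi>. continuous_map (free_topology m a b) euclideanreal \<psi> \<and>
    (\<forall>z\<in>points (free_nilspace m a b). \<psi> z - \<theta> z \<in> \<int>) \<and>
    (\<forall>N c. finite N \<longrightarrow> d \<le> card N \<longrightarrow> free_cube m a b N c \<longrightarrow> alt N (\<lambda>W. \<psi> (c W)) = 0)"
proof -
  obtain \<psi>0 where \<psi>0: "continuous_map (free_topology m a b) euclideanreal \<psi>0"
    "\<And>z. z \<in> points (free_nilspace m a b) \<Longrightarrow> \<psi>0 z - \<theta> z \<in> \<int>"
    using continuous_lift_mod_1[OF cont] by blast
  have poly0: "alt N (\<lambda>W. \<psi>0 (c W)) \<in> \<int>" if "finite N" "d \<le> card N" "free_cube m a b N c" for N c
  proof -
    have *: "alt N (\<lambda>W. \<psi>0 (c W) - \<theta> (c W)) \<in> \<int>"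
      unfolding alt_def using \<psi>0(2) that(3) by (intro Ints_sum Ints_mult) (auto simp: free_cube_def)
    show ?thesis
      using Ints_iff_of_diff[OF *[unfolded alt_diff]] poly[OF that] by simp
  qed
  define I where "I = Sigma {1..m} (\<lambda>i. {..<a i})"
  define f where "f = (\<lambda>x. \<psi>0 (free_point m a b x (\<lambda>_. 0)))"
  \<comment> \<open>The coordinate \<open>(i, p)\<close> lies in the factor of degree
    \<open>i\<close>, so the weight function is \<open>fst\<close>.\<close>
  have "\<exists>f'. (\<forall>x. (\<forall>j. j \<notin> I \<longrightarrow> x j = 0) \<longrightarrow> f' x - f x \<in> \<int>) \<and>
    (\<forall>N c. finite N \<longrightarrow> d \<le> card N \<longrightarrow> icube fst I N c \<longrightarrow> alt N (\<lambda>W. f' (c W)) = 0)"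
  proof (rule integral_polynomial_lift)
    fix N c assume "finite N" "d \<le> card N" and c: "icube fst I N c"
    moreover have "free_cube m a b N (\<lambda>W. free_point m a b (c W) (\<lambda>_. 0))"
      using c by (auto simp: free_cube_def) (auto simp: free_point_def icube_def I_def scube_zero)
    ultimately show "alt N (\<lambda>W. f (c W)) \<in> \<int>"
      unfolding f_def by (intro poly0)
  qed (auto simp: I_def)
  then obtain f' where f': "\<And>x. (\<forall>j. j \<notin> I \<longrightarrow> x j = 0) \<Longrightarrow> f' x - f x \<in> \<int>"
    "\<And>N c. finite N \<Longrightarrow> d \<le> card N \<Longrightarrow> icube fst I N c \<Longrightarrow> alt N (\<lambda>W. f' (c W)) = 0"
    by blast
  \<comment> \<open>The added term is integer-valued, which preserves the congruence, and depends
    only on the integer coordinates, which preserves continuity.\<close>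
  define \<psi> where "\<psi> = (\<lambda>z. \<psi>0 z + (f' (int_coords m a z) - f (int_coords m a z)))"
  have "continuous_map (free_topology m a b) euclideanreal \<psi>"
    unfolding \<psi>_def
    by (rule continuous_map_by_int_coords[where H = "\<lambda>x z. \<psi>0 z + (f' x - f x)"])
      (intro continuous_map_add \<psi>0, simp)
  moreover have "\<psi> z - \<theta> z \<in> \<int>" if "z \<in> points (free_nilspace m a b)" for z
  proof -
    have "f' (int_coords m a z) - f (int_coords m a z) \<in> \<int>"
      by (rule f') (auto simp: int_coords_def I_def)
    from Ints_add[OF \<psi>0(2)[OF that] this] show ?thesis by (simp add: \<psi>_def algebra_simps)
  qed
  moreover have "alt N (\<lambda>W. \<psi> (c W)) = 0" if N: "finite N" "d \<le> card N" and c: "free_cube m a b N c" for N c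
  proof -
    have "icube fst I N (\<lambda>W. int_coords m a (c W))"
      using c by (auto simp: icube_def I_def free_cube_def int_coords_def)
    then have "alt N (\<lambda>W. f' (int_coords m a (c W))) = 0"
      using f'(2) N by blast
    moreover have "alt N (\<lambda>W. \<psi>0 (c W)) = alt N (\<lambda>W. f (int_coords m a (c W)))"
      unfolding f_def using poly0[OF N] by (intro alt_contract_real_coords \<psi>0 c)
    ultimately show ?thesis by (simp add: \<psi>_def alt_add alt_diff)
  qed
  ultimately show ?thesis by blast
qed

section \<open>Lifting the coordinates of the Lie group\<close>

lemma subgroup_Ints_real_group: "subgroup \<int> real_group"
proof (rule group.subgroupI[OF group_real_group])
  fix x :: real assume "x \<in> \<int>"
  moreover have "inv\<^bsub>real_group\<^esub> x = - x"
    by (rule group.inv_equality[OF group_real_group]) (auto simp: real_group_def)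
  ultimately show "inv\<^bsub>real_group\<^esub> x \<in> \<int>" by simp
qed (auto simp: real_group_def)

lemma comm_group_circle_group: "comm_group circle_group"
  unfolding circle_group_def
  by (rule comm_group.abelian_FactGroup[OF comm_group_real_group subgroup_Ints_real_group])

lemma mem_circle_proj_iff: "t \<in> circle_proj x \<longleftrightarrow> t - x \<in> \<int>"
proof
  assume "t - x \<in> \<int>"
  then show "t \<in> circle_proj x"
    unfolding circle_proj_def r_coset_def real_group_def by (auto intro!: bexI[of _ "t - x"])
qed (auto simp: circle_proj_def r_coset_def real_group_def)

lemma circle_proj_eq_iff: "circle_proj x = circle_proj y \<longleftrightarrow> x - y \<in> \<int>"
proof
  assume "circle_proj x = circle_proj y"
  moreover have "x \<in> circle_proj x" by (simp add: mem_circle_proj_iff)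
  ultimately show "x - y \<in> \<int>" by (simp add: mem_circle_proj_iff)
next
  assume xy: "x - y \<in> \<int>"
  have "t - x \<in> \<int> \<longleftrightarrow> t - y \<in> \<int>" for t
    by (rule Ints_iff_of_diff) (use Ints_minus[OF xy] in simp)
  then show "circle_proj x = circle_proj y"
    by (simp add: set_eq_iff mem_circle_proj_iff)
qed

lemma circle_proj_add: "circle_proj x \<otimes>\<^bsub>circle_group\<^esub> circle_proj y = circle_proj (x + y)"
proof -
  interpret normal \<int> real_group
    by (rule comm_group.subgroup_imp_normal[OF comm_group_real_group subgroup_Ints_real_group])
  show ?thesis
    using rcos_sum[of x y] by (simp add: circle_group_def circle_proj_def FactGroup_def) (simp add: real_group_def)
qed

lemma circle_proj_0: "circle_proj 0 = \<one>\<^bsub>circle_group\<^esub>"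
  by (auto simp: circle_proj_def circle_group_def FactGroup_def r_coset_def real_group_def)

text \<open>The exponential has period 1, so it descends continuously along the quotient
  map.\<close>

lemma circle_character:
  "\<exists>\<xi>. continuous_map circle_topology euclidean \<xi> \<and> (\<forall>y. \<xi> (circle_proj y) = cis (2 * pi * y))"
proof (rule quotient_map_lift_exists[OF quotient_map_circle_proj])
  show "continuous_map euclideanreal euclidean (\<lambda>y. cis (2 * pi * y))"
    by (auto intro!: continuous_intros)
  fix x y assume "circle_proj x = circle_proj y"
  then have "cis (2 * pi * (x - y)) = 1" by (simp only: circle_proj_eq_iff cis_2pi_eq_1_iff)
  then show "cis (2 * pi * x) = cis (2 * pi * y)"
    by (simp add: right_diff_distrib flip: cis_divide)
qed auto

lemma carrier_lie_group: "carrier (lie_group Z s) = carrier Z \<times> ({..<s} \<rightarrow>\<^sub>E range circle_proj)"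
  by (simp add: lie_group_def range_circle_proj)

lemma comm_group_lie_group: "comm_group Z \<Longrightarrow> comm_group (lie_group Z s)"
  unfolding lie_group_def by (intro comm_group_DirProd comm_group_product_group comm_group_circle_group)

lemma lift_circle_coordinate:
  assumes "comm_group Z" "j < s"
    and \<phi>: "nilspace_morphism (free_nilspace m a b) (D_nilspace k (lie_group Z s)) \<phi>"
    and cont: "continuous_map (free_topology m a b) (lie_topology Z s) \<phi>"
  shows "\<exists>\<psi>. continuous_map (free_topology m a b) euclideanreal \<psi> \<and>
    (\<forall>z\<in>points (free_nilspace m a b). circle_proj (\<psi> z) = snd (\<phi> z) j) \<and>
    (\<forall>N c. finite N \<longrightarrow> k + 1 \<le> card N \<longrightarrow> free_cube m a b N c \<longrightarrow> alt N (\<lambda>W. \<psi> (c W)) = 0)"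
proof -
  obtain \<xi> where \<xi>: "continuous_map circle_topology euclidean \<xi>" "\<And>y. \<xi> (circle_proj y) = cis (2 * pi * y)"
    using circle_character by blast
  \<comment> \<open>Representatives are chosen without any regard to continuity; only the
    exponential of \<open>\<theta>\<close> has to be continuous.\<close>
  define \<theta> where "\<theta> = (\<lambda>z. SOME y. circle_proj y = snd (\<phi> z) j)"
  have \<theta>: "circle_proj (\<theta> z) = snd (\<phi> z) j" if "z \<in> points (free_nilspace m a b)" for z
  proof -
    have "\<phi> z \<in> carrier (lie_group Z s)"
      using \<phi> that by (auto simp: nilspace_morphism_def D_nilspace_def)
    then have "snd (\<phi> z) j \<in> range circle_proj"
      using \<open>j < s\<close> by (auto simp: carrier_lie_group mem_Times_iff PiE_iff)
    then obtain y where "circle_proj y = snd (\<phi> z) j" by (metis imageE)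
    then show ?thesis unfolding \<theta>_def by (rule someI)
  qed
  have "continuous_map (free_topology m a b) (product_topology (\<lambda>_. circle_topology) {..<s}) (\<lambda>z. snd (\<phi> z))"
    using cont unfolding lie_topology_def by (rule continuous_map_snd_of[unfolded o_def])
  then have "continuous_map (free_topology m a b) circle_topology (\<lambda>z. snd (\<phi> z) j)"
    by (rule continuous_map_product_then_coordinatewise) (use assms in simp)
  from continuous_map_compose[OF this \<xi>(1)]
  have "continuous_map (free_topology m a b) euclidean (\<lambda>z. \<xi> (snd (\<phi> z) j))" by (simp add: o_def)
  then have cont\<theta>: "continuous_map (free_topology m a b) euclidean (\<lambda>z. cis (2 * pi * \<theta> z))"
    by (rule continuous_map_eq) (simp add: topspace_free_topology \<xi>(2) flip: \<theta>)
  have "alt N (\<lambda>W. \<theta> (c W)) \<in> \<int>" if "finite N" "k + 1 \<le> card N" "free_cube m a b N c" for N c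
  proof (rule alt_character_Ints[OF comm_group_lie_group[OF assms(1)] \<phi> _ _ _ that])
    fix x y assume "x \<in> carrier (lie_group Z s)" "y \<in> carrier (lie_group Z s)"
    then have "snd x j \<in> range circle_proj" "snd y j \<in> range circle_proj"
      using \<open>j < s\<close> by (auto simp: carrier_lie_group mem_Times_iff PiE_iff)
    then obtain t u where "snd x j = circle_proj t" "snd y j = circle_proj u" by auto
    then show "\<xi> (snd (x \<otimes>\<^bsub>lie_group Z s\<^esub> y) j) = \<xi> (snd x j) * \<xi> (snd y j)"
      using \<open>j < s\<close> by (cases x; cases y) (simp add: lie_group_def circle_proj_add \<xi>(2) cis_mult distrib_left)
  next
    show "\<xi> (snd \<one>\<^bsub>lie_group Z s\<^esub> j) = 1"
      using \<open>j < s\<close> \<xi>(2)[of 0] by (simp add: lie_group_def circle_proj_0)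
  qed (simp add: \<xi>(2) flip: \<theta>)
  from polynomial_lift_mod_1[OF cont\<theta> this]
  obtain \<psi> where \<psi>: "continuous_map (free_topology m a b) euclideanreal \<psi>"
    "\<forall>z\<in>points (free_nilspace m a b). \<psi> z - \<theta> z \<in> \<int>"
    "\<forall>N c. finite N \<longrightarrow> k + 1 \<le> card N \<longrightarrow> free_cube m a b N c \<longrightarrow> alt N (\<lambda>W. \<psi> (c W)) = 0"
    by blast
  then have "\<forall>z\<in>points (free_nilspace m a b). circle_proj (\<psi> z) = snd (\<phi> z) j"
    using \<theta> by (simp flip: circle_proj_eq_iff)
  with \<psi> show ?thesis by blast
qed

section \<open>The cyclic factors of the finite part\<close>

text \<open>\<open>integer_mod_group 0\<close> is the infinite group of integers. Excluding it
  permits division by \<open>n l\<close> below.\<close>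

lemma product_integer_mod_group_finite:
  assumes "finite (carrier (product_group I (\<lambda>j. integer_mod_group (n j))))" "l \<in> I"
  shows "n l \<noteq> 0"
proof
  assume "n l = 0"
  let ?C = "carrier (product_group I (\<lambda>j. integer_mod_group (n j)))"
  have "u \<in> (\<lambda>x. x l) ` ?C" for u :: int
  proof (rule image_eqI[where x = "\<lambda>j\<in>I. if j = l then u else 0"])
    show "(\<lambda>j\<in>I. if j = l then u else 0) \<in> ?C"
      using \<open>n l = 0\<close> by (auto simp: carrier_integer_mod_group)
  qed (use assms in simp)
  then have "(\<lambda>x. x l) ` ?C = UNIV" by blast
  with assms(1) show False
    by (metis finite_imageI infinite_UNIV_int)
qed

text \<open>The floor is discontinuous on the line, but an integer value is isolated from the others
  by its open unit ball.\<close>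

lemma continuous_map_floor_Ints:
  assumes "continuous_map X euclideanreal g" "\<And>z. z \<in> topspace X \<Longrightarrow> g z \<in> \<int>"
  shows "continuous_map X (discrete_topology UNIV) (\<lambda>z. \<lfloor>g z\<rfloor>)"
  unfolding continuous_map_def
proof (intro conjI allI impI)
  fix U :: "int set"
  let ?V = "\<Union>k\<in>U. ball (of_int k) 1 :: real set"
  have "{z \<in> topspace X. \<lfloor>g z\<rfloor> \<in> U} = {z \<in> topspace X. g z \<in> ?V}"
  proof (intro Collect_cong conj_cong refl)
    fix z assume "z \<in> topspace X"
    then obtain i where i: "g z = of_int i" using assms(2) by (meson Ints_cases)
    have "dist (of_int k :: real) (of_int i) < 1 \<longleftrightarrow> k = i" for k
    proof -
      have "dist (of_int k :: real) (of_int i) = of_int \<bar>k - i\<bar>" by (simp add: dist_real_def)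
      then show ?thesis by (metis abs_eq_0 eq_iff_diff_eq_0 of_int_less_1_iff zero_less_abs_iff int_one_le_iff_zero_less not_less zero_less_one)
    qed
    then show "\<lfloor>g z\<rfloor> \<in> U \<longleftrightarrow> g z \<in> ?V" by (auto simp: i)
  qed
  then show "openin X {z \<in> topspace X. \<lfloor>g z\<rfloor> \<in> U}"
    using openin_continuous_map_preimage[OF assms(1), of ?V] by auto
qed auto

text \<open>Dividing the residue by \<open>n l\<close> embeds the cyclic factor into the circle. A
  real lift of the quotient, multiplied by \<open>n l\<close>, takes integer values in the right
  residue class.\<close>

lemma lift_finite_coordinate:
  assumes Z: "comm_group Z" "finite (carrier Z)" and "l < r"
    and h: "h \<in> iso (product_group {..<r} (\<lambda>j. integer_mod_group (n j))) Z"
    and \<phi>: "nilspace_morphism (free_nilspace m a b) (D_nilspace k (lie_group Z s)) \<phi>"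
    and cont: "continuous_map (free_topology m a b) (lie_topology Z s) \<phi>"
  shows "\<exists>\<psi>. continuous_map (free_topology m a b) (discrete_topology UNIV) \<psi> \<and>
    (\<forall>z\<in>points (free_nilspace m a b). \<psi> z mod int (n l) =
      inv_into (carrier (product_group {..<r} (\<lambda>j. integer_mod_group (n j)))) h (fst (\<phi> z)) l) \<and>
    (\<forall>N c. finite N \<longrightarrow> k + 1 \<le> card N \<longrightarrow> free_cube m a b N c \<longrightarrow> alt N (\<lambda>W. \<psi> (c W)) = 0)"
proof -
  let ?P = "product_group {..<r} (\<lambda>j. integer_mod_group (n j))"
  define h' where "h' = inv_into (carrier ?P) h"
  have P: "group ?P" by simp
  have "group Z" using Z(1) by (simp add: comm_group_def)
  have "bij_betw h (carrier ?P) (carrier Z)" using h by (simp add: iso_def)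
  then have "finite (carrier ?P)" using Z(2) bij_betw_finite by blast
  then have nl: "n l \<noteq> 0" using \<open>l < r\<close> by (intro product_integer_mod_group_finite) auto
  have h'_iso: "h' \<in> iso Z ?P" unfolding h'_def by (rule group.iso_set_sym[OF P h])
  then have h'_hom: "h' \<in> hom Z ?P" by (simp add: iso_def)
  have h'_mult: "h' (x \<otimes>\<^bsub>Z\<^esub> y) l = (h' x l + h' y l) mod int (n l)" if "x \<in> carrier Z" "y \<in> carrier Z" for x y
    using hom_mult[OF h'_hom that] \<open>l < r\<close> by simp
  have h'_one: "h' \<one>\<^bsub>Z\<^esub> l = 0"
    using hom_one[OF h'_hom \<open>group Z\<close> P] \<open>l < r\<close> by simp
  have h'_range: "0 \<le> h' x l" "h' x l < int (n l)" if "x \<in> carrier Z" for x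
  proof -
    have "h' x l \<in> carrier (integer_mod_group (n l))"
      using hom_in_carrier[OF h'_hom that] \<open>l < r\<close> by (auto simp: PiE_iff)
    then show "0 \<le> h' x l" "h' x l < int (n l)"
      using nl by (simp_all add: carrier_integer_mod_group)
  qed
  \<comment> \<open>This character of the integers has period \<open>n l\<close>, so it is
    multiplicative on remainders as well.\<close>
  define e where "e = (\<lambda>x. cis (2 * pi * (of_int x / of_nat (n l))))"
  have e_mod: "e (x mod int (n l)) = e x" for x
  proof -
    have "real_of_int x = of_int (x div int (n l)) * of_nat (n l) + of_int (x mod int (n l))"
      by (metis div_mult_mod_eq of_int_add of_int_mult of_int_of_nat_eq)
    then have "2 * pi * (of_int x / of_nat (n l)) =
        2 * pi * of_int (x div int (n l)) + 2 * pi * (of_int (x mod int (n l)) / of_nat (n l))"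
      using nl by (simp add: field_simps)
    then show ?thesis unfolding e_def by (simp add: cis_multiple_2pi flip: cis_mult)
  qed
  have e_add: "e (x + y) = e x * e y" for x y
    by (simp add: e_def cis_mult add_divide_distrib distrib_left)
  define \<theta> where "\<theta> = (\<lambda>z. of_int (h' (fst (\<phi> z)) l) / real (n l))"
  have "continuous_map (free_topology m a b) (discrete_topology (carrier Z)) (\<lambda>z. fst (\<phi> z))"
    using cont unfolding lie_topology_def by (rule continuous_map_fst_of[unfolded o_def])
  moreover have "continuous_map (discrete_topology (carrier Z)) euclidean (\<lambda>x. e (h' x l))" by simp
  ultimately have "continuous_map (free_topology m a b) euclidean (\<lambda>z. e (h' (fst (\<phi> z)) l))"
    using continuous_map_compose[of _ _ "\<lambda>z. fst (\<phi> z)" _ "\<lambda>x. e (h' x l)"] by (simp add: o_def)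
  then have cont\<theta>: "continuous_map (free_topology m a b) euclidean (\<lambda>z. cis (2 * pi * \<theta> z))"
    by (simp add: e_def \<theta>_def)
  have "alt N (\<lambda>W. \<theta> (c W)) \<in> \<int>" if "finite N" "k + 1 \<le> card N" "free_cube m a b N c" for N c
  proof (rule alt_character_Ints[OF comm_group_lie_group[OF Z(1)] \<phi> _ _ _ that])
    fix x y assume "x \<in> carrier (lie_group Z s)" "y \<in> carrier (lie_group Z s)"
    then show "e (h' (fst (x \<otimes>\<^bsub>lie_group Z s\<^esub> y)) l) = e (h' (fst x) l) * e (h' (fst y) l)"
      by (cases x; cases y) (simp add: lie_group_def h'_mult e_mod e_add)
  next
    show "e (h' (fst \<one>\<^bsub>lie_group Z s\<^esub>) l) = 1"
      by (simp add: lie_group_def h'_one e_def)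
  qed (simp add: e_def \<theta>_def)
  from polynomial_lift_mod_1[OF cont\<theta> this]
  obtain \<psi> where \<psi>: "continuous_map (free_topology m a b) euclideanreal \<psi>"
    "\<forall>z\<in>points (free_nilspace m a b). \<psi> z - \<theta> z \<in> \<int>"
    "\<forall>N c. finite N \<longrightarrow> k + 1 \<le> card N \<longrightarrow> free_cube m a b N c \<longrightarrow> alt N (\<lambda>W. \<psi> (c W)) = 0"
    by blast
  define g where "g = (\<lambda>z. real (n l) * \<psi> z)"
  have g: "\<exists>i. g z = of_int (h' (fst (\<phi> z)) l + int (n l) * i)" if z: "z \<in> points (free_nilspace m a b)" for z
  proof -
    obtain i where "\<psi> z - \<theta> z = of_int i" using bspec[OF \<psi>(2) z] by (meson Ints_cases)
    then have "g z = of_int (h' (fst (\<phi> z)) l + int (n l) * i)"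
      using nl by (simp add: g_def \<theta>_def field_simps)
    then show ?thesis by blast
  qed
  have g_floor: "g z = of_int \<lfloor>g z\<rfloor>" if "z \<in> points (free_nilspace m a b)" for z
    using g[OF that] by (metis floor_of_int)
  have "continuous_map (free_topology m a b) euclideanreal g"
    unfolding g_def by (intro continuous_map_real_mult_left \<psi>)
  then have "continuous_map (free_topology m a b) (discrete_topology UNIV) (\<lambda>z. \<lfloor>g z\<rfloor>)"
    by (rule continuous_map_floor_Ints) (metis g_floor Ints_of_int topspace_free_topology)
  moreover have "\<lfloor>g z\<rfloor> mod int (n l) = h' (fst (\<phi> z)) l" if z: "z \<in> points (free_nilspace m a b)" for z
  proof -
    have "\<phi> z \<in> carrier (lie_group Z s)"
      using \<phi> z by (auto simp: nilspace_morphism_def D_nilspace_def)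
    then have "fst (\<phi> z) \<in> carrier Z" by (auto simp: carrier_lie_group)
    moreover obtain i where "g z = of_int (h' (fst (\<phi> z)) l + int (n l) * i)" using g[OF z] by blast
    then have "\<lfloor>g z\<rfloor> = h' (fst (\<phi> z)) l + int (n l) * i" by (simp only: floor_of_int)
    ultimately show ?thesis using h'_range by simp
  qed
  moreover have "alt N (\<lambda>W. \<lfloor>g (c W)\<rfloor>) = 0" if "finite N" "k + 1 \<le> card N" "free_cube m a b N c" for N c
  proof -
    have "real_of_int (alt N (\<lambda>W. \<lfloor>g (c W)\<rfloor>)) = alt N (\<lambda>W. g (c W))"
      unfolding alt_of_int[symmetric] by (rule alt_cong) (use that g_floor in \<open>auto simp: free_cube_def\<close>)
    also have "\<dots> = 0" unfolding g_def alt_mult_left using \<psi>(3) that by simp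
    finally show ?thesis by simp
  qed
  ultimately show ?thesis unfolding h'_def by (intro exI[of _ "\<lambda>z. \<lfloor>g z\<rfloor>"]) auto
qed

text \<open>Continuity, the cube condition in \<open>ZR_group\<close> and the covering homomorphism
  can all be checked coordinate by coordinate, so the lifts of the single coordinates are simply put
  together.\<close>

theorem theorem3p11:
  fixes Z :: "('z, 'q) monoid_scheme"
    and r s k m :: nat
    and n a b :: "nat \<Rightarrow> nat"
    and h :: "(nat \<Rightarrow> int) \<Rightarrow> 'z"
    and \<phi> :: "(nat \<Rightarrow> (nat \<Rightarrow> int) \<times> (nat \<Rightarrow> real)) \<Rightarrow> 'z \<times> (nat \<Rightarrow> real set)"
  assumes "comm_group Z" and "finite (carrier Z)" and "group_rank Z = r"
    and "h \<in> iso (product_group {..<r} (\<lambda>j. integer_mod_group (n j))) Z"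
    and "k \<ge> 1"
    and "nilspace_morphism (free_nilspace m a b) (D_nilspace k (lie_group Z s)) \<phi>"
    and "continuous_map (free_topology m a b) (lie_topology Z s) \<phi>"
  shows "\<exists>\<psi>. nilspace_morphism (free_nilspace m a b) (D_nilspace k (ZR_group r s)) \<psi> \<and>
             continuous_map (free_topology m a b) (ZR_topology r s) \<psi> \<and>
             (\<forall>x\<in>points (free_nilspace m a b). \<phi> x = covering_hom r s n h (\<psi> x))"
proof -
  let ?X = "free_topology m a b" and ?F = "points (free_nilspace m a b)"
  let ?C = "carrier (product_group {..<r} (\<lambda>j. integer_mod_group (n j)))"
  have "\<forall>l. \<exists>\<psi>. l < r \<longrightarrow> continuous_map ?X (discrete_topology UNIV) \<psi> \<and>
    (\<forall>z\<in>?F. \<psi> z mod int (n l) = inv_into ?C h (fst (\<phi> z)) l) \<and>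
    (\<forall>N c. finite N \<longrightarrow> k + 1 \<le> card N \<longrightarrow> free_cube m a b N c \<longrightarrow> alt N (\<lambda>W. \<psi> (c W)) = 0)"
    using lift_finite_coordinate[OF assms(1,2) _ assms(4,6,7)] by blast
  from choice[OF this] obtain u where u:
    "\<And>l. l < r \<Longrightarrow> continuous_map ?X (discrete_topology UNIV) (u l)"
    "\<And>l z. l < r \<Longrightarrow> z \<in> ?F \<Longrightarrow> u l z mod int (n l) = inv_into ?C h (fst (\<phi> z)) l"
    "\<And>l N c. l < r \<Longrightarrow> finite N \<Longrightarrow> k + 1 \<le> card N \<Longrightarrow> free_cube m a b N c \<Longrightarrow> alt N (\<lambda>W. u l (c W)) = 0"
    by blast
  have "\<forall>j. \<exists>\<psi>. j < s \<longrightarrow> continuous_map ?X euclideanreal \<psi> \<and>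
    (\<forall>z\<in>?F. circle_proj (\<psi> z) = snd (\<phi> z) j) \<and>
    (\<forall>N c. finite N \<longrightarrow> k + 1 \<le> card N \<longrightarrow> free_cube m a b N c \<longrightarrow> alt N (\<lambda>W. \<psi> (c W)) = 0)"
    using lift_circle_coordinate[OF assms(1) _ assms(6,7)] by blast
  from choice[OF this] obtain v where v:
    "\<And>j. j < s \<Longrightarrow> continuous_map ?X euclideanreal (v j)"
    "\<And>j z. j < s \<Longrightarrow> z \<in> ?F \<Longrightarrow> circle_proj (v j z) = snd (\<phi> z) j"
    "\<And>j N c. j < s \<Longrightarrow> finite N \<Longrightarrow> k + 1 \<le> card N \<Longrightarrow> free_cube m a b N c \<Longrightarrow> alt N (\<lambda>W. v j (c W)) = 0"
    by blast
  define \<psi> where "\<psi> = (\<lambda>z. (\<lambda>l\<in>{..<r}. u l z, \<lambda>j\<in>{..<s}. v j z))"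
  have "nilspace_morphism (free_nilspace m a b) (D_nilspace k (ZR_group r s)) \<psi>"
    by (rule nilspace_morphism_free_ZR_group) (auto simp: \<psi>_def carrier_ZR_group u(3) v(3))
  moreover have "continuous_map ?X (ZR_topology r s) \<psi>"
    unfolding \<psi>_def ZR_topology_def
    by (intro continuous_map_pairedI) (auto simp: continuous_map_componentwise u(1) v(1))
  moreover have "\<phi> z = covering_hom r s n h (\<psi> z)" if z: "z \<in> ?F" for z
  proof -
    have "\<phi> z \<in> carrier (lie_group Z s)"
      using assms(6) z by (auto simp: nilspace_morphism_def D_nilspace_def)
    then have \<phi>z: "fst (\<phi> z) \<in> carrier Z" "snd (\<phi> z) \<in> {..<s} \<rightarrow>\<^sub>E range circle_proj"
      by (simp_all only: carrier_lie_group mem_Times_iff)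
    have img: "fst (\<phi> z) \<in> h ` ?C"
      using \<phi>z(1) assms(4) by (simp add: iso_def bij_betw_def)
    have inC: "inv_into ?C h (fst (\<phi> z)) \<in> ?C" by (rule inv_into_into[OF img])
    have h_inv: "h (inv_into ?C h (fst (\<phi> z))) = fst (\<phi> z)" by (rule f_inv_into_f[OF img])
    \<comment> \<open>The preimage under \<open>h\<close> is the tuple of residues of
      \<open>fst (\<phi> z)\<close>; the \<open>u l z\<close> reduce to its entries, and both tuples
      are extensional.\<close>
    have "(\<lambda>l\<in>{..<r}. u l z mod int (n l)) = inv_into ?C h (fst (\<phi> z))"
      using inC u(2)[OF _ z] by (intro ext) (auto simp: PiE_iff extensional_def)
    moreover have "(\<lambda>j\<in>{..<s}. circle_proj (v j z)) = snd (\<phi> z)"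
      using \<phi>z(2) v(2)[OF _ z] by (intro ext) (auto simp: PiE_iff extensional_def)
    moreover have "(\<lambda>l\<in>{..<r}. (\<lambda>l\<in>{..<r}. u l z) l mod int (n l)) = (\<lambda>l\<in>{..<r}. u l z mod int (n l))"
      "(\<lambda>j\<in>{..<s}. circle_proj ((\<lambda>j\<in>{..<s}. v j z) j)) = (\<lambda>j\<in>{..<s}. circle_proj (v j z))"
      by (auto intro!: restrict_ext)
    ultimately show ?thesis
      by (simp only: covering_hom_def \<psi>_def case_prod_conv h_inv prod.collapse)
  qed
  ultimately show ?thesis by blast
qed

end
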